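(* Let $u_0\in C_\psi$ be such that $\mathcal{E}(u_0)<G\big(\sqrt{2/3}\big)^2$ and let $u$ be an FVI gradient flow starting at $u_0$. Then there exists a sequence $t_n\to\infty$ such that $u(t_n)$ touches $\psi$ for all $n$, i.e. $\{x\in[0,1]: u(t_n)(x)=\psi(x)\}\neq\emptyset$.
   Context: The elastic energy is $\mathcal{E}: W^{2,2}(0,1)\cap W_0^{1,2}(0,1)\to\mathbb{R}$, $\mathcal{E}(u)=\int_0^1 \frac{u''(x)^2}{(1+u'(x)^2)^{5/2}}\,dx$, where $W^{2,2}(0,1)\cap W_0^{1,2}(0,1)$ carries the norm $\|u\|=\|u''\|_{L^2}$; $D\mathcal{E}$ denotes its Fréchet derivative. Set $G(s)=\int_0^s (1+t^2)^{-5/4}\,dt$. Standing assumption on the obstacle: $\psi\in C([0,1])$, $\psi(0)<0$, $\psi(1)<0$, and there is $x_0\in(0,1)$ with $\psi(x_0)>0$. Set $C_\psi=\{u\in W^{2,2}(0,1)\cap W_0^{1,2}(0,1): u\ge\psi \text{ a.e.}\}$. For a Banach space $V$, $D^{1,2}((0,\infty),V)=\{u\in W^{1,1}_{loc}((0,\infty),V): \dot u\in L^2((0,\infty),V)\}$, where $\dot u$ is the weak time derivative. $(\cdot,\cdot)$ is the scalar product of $L^2(0,1)$. For $u_0\in C_\psi$, a function $u\in L^\infty((0,\infty),W^{2,2}(0,1)\cap W_0^{1,2}(0,1))\cap D^{1,2}((0,\infty),L^2(0,1))$ is an FVI gradient flow (for $\mathcal{E}$, in $C_\psi$) starting at $u_0$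 if: (i) $u(t)\in C_\psi$ for a.e. $t>0$; (ii) $t\mapsto\mathcal{E}(u(t))$ coincides a.e. with a nonincreasing function $\phi:[0,\infty)\to\mathbb{R}$ with $\phi(0)=\mathcal{E}(u_0)$; (iii) the unique $C([0,\infty),L^2(0,1))$-representative of $u$ satisfies $u(0)=u_0$; (iv) for a.e. $t>0$: $(\dot u(t),v-u(t))+D\mathcal{E}(u(t))(v-u(t))\ge0$ for all $v\in C_\psi$. Such a $u$ has a unique representative in $C([0,\infty),C^1([0,1]))$, with which it is always identified. *)

theory Defs
  imports "HOL-Analysis.Analysis"
begin

section \<open>The Hilbert space $L^2(0,1)$\<close>

abbreviation unit_itv :: "real measure" where
  "unit_itv \<equiv> lebesgue_on {0<..<1}"

lemma finite_measure_unit_itv: "finite_measure unit_itv"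
  by (rule finite_measure_lebesgue_on) simp

definition square_integrable :: "(real \<Rightarrow> real) \<Rightarrow> bool" where
  "square_integrable f \<longleftrightarrow>
     f \<in> borel_measurable unit_itv \<and> integrable unit_itv (\<lambda>x. (f x)\<^sup>2)"

lemma square_integrable_measurable [measurable_dest]:
  "square_integrable f \<Longrightarrow> f \<in> borel_measurable unit_itv"
  by (simp add: square_integrable_def)

lemma square_integrable_0 [simp]: "square_integrable (\<lambda>x. 0)"
  by (simp add: square_integrable_def)

lemma square_integrable_mult:
  assumes "square_integrable f" "square_integrable g"
  shows "integrable unit_itv (\<lambda>x. f x * g x)"
proof (rule Bochner_Integration.integrable_bound)
  show "integrable unit_itv (\<lambda>x. (f x)\<^sup>2 + (g x)\<^sup>2)"
    using assms by (simp add: square_integrable_def)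
  show "(\<lambda>x. f x * g x) \<in> borel_measurable unit_itv"
    using assms[THEN square_integrable_measurable] by measurable
  have "\<bar>f x * g x\<bar> \<le> (f x)\<^sup>2 + (g x)\<^sup>2" for x
  proof -
    have "2 * (\<bar>f x\<bar> * \<bar>g x\<bar>) \<le> (f x)\<^sup>2 + (g x)\<^sup>2"
      using zero_le_power2[of "\<bar>f x\<bar> - \<bar>g x\<bar>"] by (simp add: power2_diff)
    then show ?thesis
      using mult_nonneg_nonneg[of "\<bar>f x\<bar>" "\<bar>g x\<bar>"] unfolding abs_mult by linarith
  qed
  then show "AE x in unit_itv. norm (f x * g x) \<le> norm ((f x)\<^sup>2 + (g x)\<^sup>2)"
    by simp
qed

lemma square_integrable_add:
  assumes "square_integrable f" "square_integrable g"
  shows "square_integrable (\<lambda>x. f x + g x)"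
  using square_integrable_mult[OF assms] assms
  by (auto simp: square_integrable_def power2_sum mult.assoc)

lemma square_integrable_scale:
  assumes "square_integrable f"
  shows "square_integrable (\<lambda>x. c * f x)"
  using assms by (auto simp: square_integrable_def power_mult_distrib)

lemma square_integrable_bounded:
  assumes "f \<in> borel_measurable unit_itv" "\<And>x. 0 < x \<Longrightarrow> x < 1 \<Longrightarrow> \<bar>f x\<bar> \<le> B"
  shows "square_integrable f"
proof -
  have "integrable unit_itv (\<lambda>x. (f x)\<^sup>2)"
  proof (rule Bochner_Integration.integrable_bound[where f = "\<lambda>_. B\<^sup>2"])
    show "integrable unit_itv (\<lambda>_. B\<^sup>2)"
      using finite_measure_unit_itv by (rule finite_measure.integrable_const)
    show "AE x in unit_itv. norm ((f x)\<^sup>2) \<le> norm (B\<^sup>2)"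
      using assms(2) by (intro AE_I2) (auto simp: abs_le_square_iff[symmetric] intro: order_trans[OF _ abs_ge_self])
  qed (use assms(1) in measurable)
  then show ?thesis using assms(1) by (simp add: square_integrable_def)
qed

quotient_type L2 = "real \<Rightarrow> real" / partial:
  "\<lambda>f g. square_integrable f \<and> square_integrable g \<and> (AE x in unit_itv. f x = g x)"
proof (rule part_equivpI)
  show "\<exists>f. square_integrable f \<and> square_integrable f \<and> (AE x in unit_itv. f x = f x)"
    by (rule exI[of _ "\<lambda>x. 0"]) auto
  show "symp (\<lambda>f g. square_integrable f \<and> square_integrable g \<and> (AE x in unit_itv. f x = g x))"
    by (auto simp: symp_def elim: eventually_mono)
  show "transp (\<lambda>f g. square_integrable f \<and> square_integrable g \<and> (AE x in unit_itv. f x = g x))"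
    by (auto simp: transp_def elim: eventually_elim2)
qed


instantiation L2 :: real_inner
begin

lift_definition zero_L2 :: L2 is "\<lambda>x. 0" by simp

lift_definition plus_L2 :: "L2 \<Rightarrow> L2 \<Rightarrow> L2" is "\<lambda>f g x. f x + g x"
  by (auto intro: square_integrable_add elim: eventually_elim2)

lift_definition scaleR_L2 :: "real \<Rightarrow> L2 \<Rightarrow> L2" is "\<lambda>c f x. c * f x"
  by (auto intro: square_integrable_scale elim: eventually_mono)

lift_definition uminus_L2 :: "L2 \<Rightarrow> L2" is "\<lambda>f x. - f x"
  using square_integrable_scale[of _ "-1"] by (auto elim: eventually_mono)

lift_definition minus_L2 :: "L2 \<Rightarrow> L2 \<Rightarrow> L2" is "\<lambda>f g x. f x - g x"
  using square_integrable_add[OF _ square_integrable_scale[of _ "-1"]]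
  by (auto elim: eventually_elim2)

lift_definition inner_L2 :: "L2 \<Rightarrow> L2 \<Rightarrow> real" is "\<lambda>f g. \<integral>x. f x * g x \<partial>unit_itv"
  by (intro integral_cong_AE) (auto dest!: square_integrable_measurable elim: eventually_elim2)

definition norm_L2 :: "L2 \<Rightarrow> real" where "norm_L2 f = sqrt (inner f f)"

definition sgn_L2 :: "L2 \<Rightarrow> L2" where "sgn_L2 f = inverse (norm f) *\<^sub>R f"

definition dist_L2 :: "L2 \<Rightarrow> L2 \<Rightarrow> real" where "dist_L2 f g = norm (f - g)"

definition uniformity_L2 :: "(L2 \<times> L2) filter" where
  "uniformity_L2 = (INF e\<in>{0<..}. principal {(f, g). dist f g < e})"

definition open_L2 :: "L2 set \<Rightarrow> bool" where
  "open_L2 S \<longleftrightarrow> (\<forall>f\<in>S. \<forall>\<^sub>F (f', g) in uniformity. f' = f \<longrightarrow> g \<in> S)"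

instance
proof
  fix a b c :: L2 and r s :: real and U :: "L2 set"
  show "a + b + c = a + (b + c)"
    by transfer (auto intro!: square_integrable_add simp: algebra_simps)
  show "a + b = b + a"
    by transfer (auto intro!: square_integrable_add simp: algebra_simps)
  show "0 + a = a" by transfer auto
  show "- a + a = 0" by transfer auto
  show "a - b = a + - b"
    by transfer (use square_integrable_add[OF _ square_integrable_scale[of _ "-1"]] in auto)
  show "r *\<^sub>R (a + b) = r *\<^sub>R a + r *\<^sub>R b"
    by transfer (auto intro!: square_integrable_add square_integrable_scale simp: algebra_simps)
  show "(r + s) *\<^sub>R a = r *\<^sub>R a + s *\<^sub>R a"
    by transfer (auto intro!: square_integrable_add square_integrable_scale simp: algebra_simps
      square_integrable_scale[of _ "r + s", simplified algebra_simps])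
  show "r *\<^sub>R s *\<^sub>R a = (r * s) *\<^sub>R a"
    by transfer (auto intro!: square_integrable_scale simp: algebra_simps
        square_integrable_scale[of _ "r * s", simplified algebra_simps])
  show "1 *\<^sub>R a = a" by transfer auto
  show "dist a b = norm (a - b)" by (simp add: dist_L2_def)
  show "sgn a = inverse (norm a) *\<^sub>R a" by (simp add: sgn_L2_def)
  show "uniformity = (INF e\<in>{0<..}. principal {(x, y). dist (x::L2) y < e})"
    by (simp add: uniformity_L2_def)
  show "open U \<longleftrightarrow> (\<forall>x\<in>U. \<forall>\<^sub>F (x', y) in uniformity. x' = x \<longrightarrow> y \<in> U)"
    by (simp add: open_L2_def)
  show "inner a b = inner b a" by transfer (simp add: mult.commute)
  show "inner (a + b) c = inner a c + inner b c"
    by transfer (simp add: distrib_right square_integrable_mult)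
  show "inner (r *\<^sub>R a) b = r * inner a b"
    by transfer (simp add: mult.assoc)
  show "0 \<le> inner a a" by transfer simp
  show "inner a a = 0 \<longleftrightarrow> a = 0"
    by transfer (auto simp: integral_nonneg_eq_0_iff_AE square_integrable_mult)
  show "norm a = sqrt (inner a a)" by (simp add: norm_L2_def)
qed

end

text \<open>
  \<open>fun_of f\<close> is an arbitrary representative of the class \<open>f\<close>; it may only be used in statements
  that do not distinguish functions which agree almost everywhere.
\<close>

definition fun_of :: "L2 \<Rightarrow> real \<Rightarrow> real" where "fun_of = rep_L2"

lemma square_integrable_fun_of: "square_integrable (fun_of f)"
  using Quotient3_rep_reflp[OF Quotient3_L2, of f] by (simp add: fun_of_def)

lemma abs_fun_of: "abs_L2 (fun_of f) = f"
  using Quotient3_abs_rep[OF Quotient3_L2, of f] by (simp add: fun_of_def)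

lemma fun_of_abs: "square_integrable f \<Longrightarrow> AE x in unit_itv. fun_of (abs_L2 f) x = f x"
  using Quotient3_rep_abs[OF Quotient3_L2, of f] by (simp add: fun_of_def)

lemma L2_eqI:
  "(AE x in unit_itv. fun_of f x = fun_of g x) \<Longrightarrow> f = g"
  using Quotient3_rel_rep[OF Quotient3_L2, of f g] square_integrable_fun_of[of f] square_integrable_fun_of[of g]
  by (simp add: fun_of_def)

subsection \<open>Completeness and separability\<close>

lemma inner_abs_L2:
  assumes "square_integrable f" "square_integrable g"
  shows "inner (abs_L2 f) (abs_L2 g) = (\<integral>x. f x * g x \<partial>unit_itv)"
  using assms by (simp add: inner_L2.abs_eq)

lemma norm_abs_L2:
  assumes "square_integrable f"
  shows "norm (abs_L2 f) = sqrt (\<integral>x. (f x)\<^sup>2 \<partial>unit_itv)"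
  using assms by (simp add: norm_eq_sqrt_inner inner_abs_L2 power2_eq_square)

lemma square_integrable_diff:
  assumes "square_integrable f" "square_integrable g"
  shows "square_integrable (\<lambda>x. f x - g x)"
  using square_integrable_add[OF assms(1) square_integrable_scale[OF assms(2), of "-1"]] by simp

lemma diff_abs_L2:
  assumes "square_integrable f" "square_integrable g"
  shows "abs_L2 f - abs_L2 g = abs_L2 (\<lambda>x. f x - g x)"
  using assms by (simp add: minus_L2.abs_eq)

lemma fun_of_diff: "AE x in unit_itv. fun_of (f - g) x = fun_of f x - fun_of g x"
  using fun_of_abs[OF square_integrable_diff[OF square_integrable_fun_of[of f] square_integrable_fun_of[of g]]]
  by (simp add: diff_abs_L2[symmetric] square_integrable_fun_of abs_fun_of)

lemma square_integrable_abs: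
  "square_integrable f \<Longrightarrow> square_integrable (\<lambda>x. \<bar>f x\<bar>)"
  by (auto simp: square_integrable_def)

lemma integral_abs_le_norm_L2:
  assumes "square_integrable f"
  shows "(\<integral>x. \<bar>f x\<bar> \<partial>unit_itv) \<le> norm (abs_L2 f)"
proof -
  have 1: "square_integrable (\<lambda>x. 1)"
    by (rule square_integrable_bounded[where B = 1]) auto
  have "(\<integral>x. \<bar>f x\<bar> \<partial>unit_itv) = inner (abs_L2 (\<lambda>x. \<bar>f x\<bar>)) (abs_L2 (\<lambda>x. 1))"
    using assms 1 by (simp add: inner_abs_L2 square_integrable_abs)
  also have "\<dots> \<le> norm (abs_L2 (\<lambda>x. \<bar>f x\<bar>)) * norm (abs_L2 (\<lambda>x. 1))"
    by (rule norm_cauchy_schwarz)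
  also have "norm (abs_L2 (\<lambda>x. 1)) = 1"
    by (simp add: norm_abs_L2 1 measure_restrict_space)
  also have "norm (abs_L2 (\<lambda>x. \<bar>f x\<bar>)) = norm (abs_L2 f)"
    using assms by (simp add: norm_abs_L2 square_integrable_abs)
  finally show ?thesis by simp
qed

lemma square_integrable_integrable:
  assumes "square_integrable f"
  shows "integrable unit_itv f"
  using square_integrable_mult[OF assms square_integrable_bounded[of "\<lambda>x. 1" 1]] by auto

text \<open>Riesz--Fischer.\<close>

instance L2 :: banach
proof
  fix X :: "nat \<Rightarrow> L2"
  assume "Cauchy X"
  then have "\<forall>k. \<exists>N. \<forall>m\<ge>N. \<forall>n\<ge>N. norm (X m - X n) < (1/2) ^ k"
    unfolding Cauchy_iff by simp
  then obtain N where N: "\<And>k m n. m \<ge> N k \<Longrightarrow> n \<ge> N k \<Longrightarrow> norm (X m - X n) < (1/2) ^ k"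
    by metis
  define r where "r k = k + (\<Sum>j\<le>k. N j)" for k
  have r: "strict_mono r"
    by (rule strict_mono_Suc_iff[THEN iffD2]) (simp add: r_def)
  have rN: "N k \<le> r m" if "k \<le> m" for k m
  proof -
    have "N k \<le> (\<Sum>j\<le>m. N j)" using that by (intro member_le_sum) auto
    then show ?thesis by (simp add: r_def)
  qed
  define F where "F k = fun_of (X (r k))" for k
  have sqF [simp]: "square_integrable (F k)" for k
    by (simp add: F_def square_integrable_fun_of)
  have absF: "abs_L2 (F k) = X (r k)" for k
    by (simp add: F_def abs_fun_of)
  have mF [measurable]: "F k \<in> borel_measurable unit_itv" for k
    by (rule square_integrable_measurable) simp
  have FF: "norm (abs_L2 (\<lambda>x. F m x - F k x)) < (1/2) ^ k" if "k \<le> m" for k m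
    using N[of k "r m" "r k"] rN[OF that] rN[of k k] by (simp add: diff_abs_L2[symmetric] absF)
  have "AE x in unit_itv. summable (\<lambda>k. F (Suc k) x - F k x)"
  proof -
    have "(\<integral>\<^sup>+x. (\<Sum>k. ennreal \<bar>F (Suc k) x - F k x\<bar>) \<partial>unit_itv)
        = (\<Sum>k. \<integral>\<^sup>+x. ennreal \<bar>F (Suc k) x - F k x\<bar> \<partial>unit_itv)"
      by (rule nn_integral_suminf) simp
    also have "\<dots> \<le> (\<Sum>k. ennreal ((1/2) ^ k))"
    proof (rule suminf_le)
      fix k
      have sq: "square_integrable (\<lambda>x. F (Suc k) x - F k x)"
        by (simp add: square_integrable_diff)
      have "(\<integral>\<^sup>+x. ennreal \<bar>F (Suc k) x - F k x\<bar> \<partial>unit_itv)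
          = ennreal (\<integral>x. \<bar>F (Suc k) x - F k x\<bar> \<partial>unit_itv)"
        by (rule nn_integral_eq_integral)
           (auto intro!: square_integrable_integrable square_integrable_abs sq simp del: integrable_abs)
      also have "\<dots> \<le> ennreal ((1/2) ^ k)"
        using integral_abs_le_norm_L2[OF sq] FF[of k "Suc k"] by (intro ennreal_leI) auto
      finally show "(\<integral>\<^sup>+x. ennreal \<bar>F (Suc k) x - F k x\<bar> \<partial>unit_itv) \<le> ennreal ((1/2) ^ k)" .
    qed auto
    also have "\<dots> = ennreal (\<Sum>k. (1/2) ^ k)"
      by (rule suminf_ennreal2) (auto intro: summable_geometric)
    also have "\<dots> < \<infinity>" by simp
    finally have "AE x in unit_itv. (\<Sum>k. ennreal \<bar>F (Suc k) x - F k x\<bar>) \<noteq> \<infinity>"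
      by (intro nn_integral_PInf_AE) auto
    then show ?thesis
      by (rule eventually_mono)
         (auto intro!: summable_rabs_cancel[OF summable_suminf_not_top])
  qed
  then have conv: "AE x in unit_itv. convergent (\<lambda>k. F k x)"
  proof (rule eventually_mono)
    fix x assume "summable (\<lambda>k. F (Suc k) x - F k x)"
    then have "convergent (\<lambda>n. \<Sum>k<n. F (Suc k) x - F k x)"
      by (simp add: summable_iff_convergent)
    then have "convergent (\<lambda>n. F n x - F 0 x)"
      by (simp add: sum_lessThan_telescope[of "\<lambda>k. F k x"])
    then show "convergent (\<lambda>n. F n x)"
      by (simp add: convergent_diff_const_right_iff)
  qed
  define f where "f x = lim (\<lambda>k. F k x)" for x
  have mf [measurable]: "f \<in> borel_measurable unit_itv"
    unfolding f_def by (rule borel_measurable_lim_metric) simp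
  have lim: "AE x in unit_itv. (\<lambda>k. F k x) \<longlonglongrightarrow> f x"
    using conv by (rule eventually_mono) (simp add: f_def convergent_LIMSEQ_iff)
  have le: "(\<integral>\<^sup>+x. ennreal ((f x - F k x)\<^sup>2) \<partial>unit_itv) \<le> ennreal (((1/2) ^ k)\<^sup>2)" for k
  proof -
    have "(\<integral>\<^sup>+x. ennreal ((f x - F k x)\<^sup>2) \<partial>unit_itv)
        = (\<integral>\<^sup>+x. liminf (\<lambda>m. ennreal ((F m x - F k x)\<^sup>2)) \<partial>unit_itv)"
    proof (rule nn_integral_cong_AE, use lim in \<open>rule eventually_mono\<close>)
      fix x assume "(\<lambda>k. F k x) \<longlonglongrightarrow> f x"
      then have "(\<lambda>m. ennreal ((F m x - F k x)\<^sup>2)) \<longlonglongrightarrow> ennreal ((f x - F k x)\<^sup>2)"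
        by (intro tendsto_intros)
      then show "ennreal ((f x - F k x)\<^sup>2) = liminf (\<lambda>m. ennreal ((F m x - F k x)\<^sup>2))"
        by (intro lim_imp_Liminf[symmetric]) auto
    qed
    also have "\<dots> \<le> liminf (\<lambda>m. \<integral>\<^sup>+x. ennreal ((F m x - F k x)\<^sup>2) \<partial>unit_itv)"
      by (rule nn_integral_liminf) simp
    also have "\<dots> \<le> ennreal (((1/2) ^ k)\<^sup>2)"
    proof -
      have "(\<integral>\<^sup>+x. ennreal ((F m x - F k x)\<^sup>2) \<partial>unit_itv) \<le> ennreal (((1/2) ^ k)\<^sup>2)" if "k \<le> m" for m
      proof -
        have sq: "square_integrable (\<lambda>x. F m x - F k x)" by (simp add: square_integrable_diff)
        then have "(\<integral>\<^sup>+x. ennreal ((F m x - F k x)\<^sup>2) \<partial>unit_itv)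
            = ennreal (\<integral>x. (F m x - F k x)\<^sup>2 \<partial>unit_itv)"
          by (intro nn_integral_eq_integral) (auto simp: square_integrable_def)
        also have "(\<integral>x. (F m x - F k x)\<^sup>2 \<partial>unit_itv) = (norm (abs_L2 (\<lambda>x. F m x - F k x)))\<^sup>2"
          by (simp add: norm_abs_L2 sq)
        also have "ennreal \<dots> \<le> ennreal (((1/2) ^ k)\<^sup>2)"
          using FF[OF that] by (intro ennreal_leI power_mono) auto
        finally show ?thesis .
      qed
      then have "\<forall>\<^sub>F m in sequentially. (\<integral>\<^sup>+x. ennreal ((F m x - F k x)\<^sup>2) \<partial>unit_itv) \<le> ennreal (((1/2) ^ k)\<^sup>2)"
        by (auto simp: eventually_sequentially)
      then have "liminf (\<lambda>m. \<integral>\<^sup>+x. ennreal ((F m x - F k x)\<^sup>2) \<partial>unit_itv) \<le> liminf (\<lambda>m. ennreal (((1/2) ^ k)\<^sup>2))"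
        by (rule Liminf_mono)
      then show ?thesis by (simp add: Liminf_const)
    qed
    finally show ?thesis .
  qed
  have sqd: "square_integrable (\<lambda>x. f x - F k x)" for k
    unfolding square_integrable_def
  proof
    show "integrable unit_itv (\<lambda>x. (f x - F k x)\<^sup>2)"
    proof (rule integrableI_nonneg)
      show "(\<integral>\<^sup>+x. ennreal ((f x - F k x)\<^sup>2) \<partial>unit_itv) < \<infinity>"
        using le[of k] by (rule order.strict_trans1) simp
    qed auto
  qed simp
  have sqf: "square_integrable f"
    using square_integrable_add[OF sqd[of 0], of "F 0"] by simp
  have "norm (X (r k) - abs_L2 f) \<le> (1/2) ^ k" for k
  proof -
    have "ennreal (\<integral>x. (f x - F k x)\<^sup>2 \<partial>unit_itv) \<le> ennreal (((1/2) ^ k)\<^sup>2)"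
      using le[of k] sqd[of k] by (subst nn_integral_eq_integral[symmetric]) (auto simp: square_integrable_def)
    then have "(\<integral>x. (f x - F k x)\<^sup>2 \<partial>unit_itv) \<le> ((1/2) ^ k)\<^sup>2"
      by (simp add: ennreal_le_iff)
    then have "norm (abs_L2 f - X (r k)) \<le> (1/2) ^ k"
      unfolding absF[symmetric] diff_abs_L2[OF sqf sqF] norm_abs_L2[OF sqd]
      by (intro real_le_lsqrt) auto
    then show ?thesis by (simp add: norm_minus_commute)
  qed
  moreover have "(\<lambda>k. (1/2::real) ^ k) \<longlonglongrightarrow> 0" by (rule LIMSEQ_realpow_zero) auto
  ultimately have "(\<lambda>k. X (r k) - abs_L2 f) \<longlonglongrightarrow> 0"
    by (intro Lim_null_comparison[of "\<lambda>k. X (r k) - abs_L2 f" "\<lambda>k. (1/2) ^ k"]) auto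
  then have "(X \<circ> r) \<longlonglongrightarrow> abs_L2 f"
    by (simp add: LIM_zero_iff o_def)
  with \<open>Cauchy X\<close> r show "convergent X"
    by (metis Cauchy_converges_subseq convergent_def)
qed

lemma countable_subbasis_if_dense:
  fixes D :: "'a::metric_space set"
  assumes "countable D" and dense: "\<And>x e. e > 0 \<Longrightarrow> \<exists>d\<in>D. dist d x < e"
  shows "\<exists>B::'a set set. countable B \<and> open = generate_topology B"
proof (intro exI conjI ext iffI)
  let ?B = "(\<lambda>(d, n). ball d (1 / Suc n)) ` (D \<times> (UNIV :: nat set))"
  show "countable ?B" using assms(1) by (intro countable_image countable_SIGMA) auto
  fix S :: "'a set"
  show "generate_topology ?B S" if "open S"
  proof -
    have "S = \<Union>{b \<in> ?B. b \<subseteq> S}"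
    proof (intro equalityI subsetI)
      fix x assume "x \<in> S"
      with that obtain e where e: "e > 0" "ball x e \<subseteq> S" by (meson open_contains_ball)
      obtain n :: nat where n: "1 / Suc n < e / 2"
        using reals_Archimedean[of "e/2"] e(1) by (auto simp: field_simps)
      obtain d where d: "d \<in> D" "dist d x < 1 / Suc n" using dense[of "1 / Suc n" x] by auto
      have "ball d (1 / Suc n) \<subseteq> ball x e"
      proof
        fix y assume "y \<in> ball d (1 / Suc n)"
        then have "dist x y < 1 / Suc n + 1 / Suc n"
          using d(2) dist_triangle[of x y d] by (simp add: dist_commute)
        then show "y \<in> ball x e" using n by simp
      qed
      then have "ball d (1 / Suc n) \<in> {b \<in> ?B. b \<subseteq> S}" using d(1) e(2) by auto
      moreover have "x \<in> ball d (1 / Suc n)" using d(2) by simp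
      ultimately show "x \<in> \<Union>{b \<in> ?B. b \<subseteq> S}" by (rule UnionI)
    qed auto
    moreover have "generate_topology ?B (\<Union>{b \<in> ?B. b \<subseteq> S})"
      by (rule generate_topology.UN) (auto intro: generate_topology.Basis)
    ultimately show ?thesis by metis
  qed
  show "open S" if "generate_topology ?B S"
    using that by induction auto
qed

definition rat_bernstein :: "rat list \<Rightarrow> real \<Rightarrow> real" where
  "rat_bernstein q x = (\<Sum>k\<le>length q - 1. real_of_rat (q ! k) * Bernstein (length q - 1) k x)"

lemma rat_bernstein_measurable [measurable]: "rat_bernstein q \<in> borel_measurable unit_itv"
proof -
  have "rat_bernstein q \<in> borel_measurable borel"
    unfolding rat_bernstein_def Bernstein_def by measurable
  then show ?thesis
    using borel_measurable_subalgebra[of borel lebesgue "rat_bernstein q"]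
    by (intro measurable_restrict_space1 measurable_completion) simp
qed

lemma rat_bernstein_dense:
  assumes "continuous_on {0..1} g" "e > 0"
  obtains q where "\<And>x. 0 \<le> x \<Longrightarrow> x \<le> 1 \<Longrightarrow> \<bar>g x - rat_bernstein q x\<bar> < e"
proof -
  obtain N where N: "\<And>n x. N \<le> n \<Longrightarrow> x \<in> {0..1} \<Longrightarrow> \<bar>g x - (\<Sum>k\<le>n. g (k / n) * Bernstein n k x)\<bar> < e / 2"
    using Bernstein_Weierstrass[OF assms(1), of "e/2"] assms(2) by auto
  have "\<exists>s::rat. \<bar>g (k / N) - real_of_rat s\<bar> < e / 2" for k :: nat
  proof -
    obtain s where "g (k / N) - e / 2 < real_of_rat s" "real_of_rat s < g (k / N) + e / 2"
      using of_rat_dense[of "g (k / N) - e / 2" "g (k / N) + e / 2"] assms(2) by auto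
    then have "\<bar>g (k / N) - real_of_rat s\<bar> < e / 2" by linarith
    then show ?thesis by blast
  qed
  then obtain s :: "nat \<Rightarrow> rat" where s: "\<And>k. \<bar>g (real k / N) - real_of_rat (s k)\<bar> < e / 2"
    by metis
  define q where "q = map s [0..<Suc N]"
  have q: "rat_bernstein q x = (\<Sum>k\<le>N. real_of_rat (s k) * Bernstein N k x)" for x
    unfolding rat_bernstein_def q_def by (auto intro!: sum.cong simp del: upt_Suc)
  show thesis
  proof
    fix x :: real assume x: "0 \<le> x" "x \<le> 1"
    have "\<bar>(\<Sum>k\<le>N. g (k / N) * Bernstein N k x) - rat_bernstein q x\<bar>
        = \<bar>\<Sum>k\<le>N. (g (k / N) - real_of_rat (s k)) * Bernstein N k x\<bar>"
      by (simp add: q sum_subtractf[symmetric] algebra_simps)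
    also have "\<dots> \<le> (\<Sum>k\<le>N. e / 2 * Bernstein N k x)"
    proof (intro order_trans[OF sum_abs] sum_mono)
      fix k
      show "\<bar>(g (k / N) - real_of_rat (s k)) * Bernstein N k x\<bar> \<le> e / 2 * Bernstein N k x"
        unfolding abs_mult abs_of_nonneg[OF Bernstein_nonneg[OF x]]
        by (rule mult_right_mono[OF less_imp_le[OF s] Bernstein_nonneg[OF x]])
    qed
    also have "\<dots> = e / 2" unfolding sum_distrib_left[symmetric] by simp
    finally have "\<bar>(\<Sum>k\<le>N. g (k / N) * Bernstein N k x) - rat_bernstein q x\<bar> \<le> e / 2" .
    moreover have "\<bar>g x - (\<Sum>k\<le>N. g (k / N) * Bernstein N k x)\<bar> < e / 2" using N[of N x] x by simp
    ultimately show "\<bar>g x - rat_bernstein q x\<bar> < e" by linarith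
  qed
qed

lemma L2_tendsto_dominated:
  assumes sq: "square_integrable f" "\<And>n. square_integrable (g n)" "square_integrable w"
    and lim: "AE x in unit_itv. (\<lambda>n. g n x) \<longlonglongrightarrow> f x"
    and bd: "\<And>n. AE x in unit_itv. \<bar>g n x - f x\<bar> \<le> w x"
  shows "(\<lambda>n. abs_L2 (g n)) \<longlonglongrightarrow> abs_L2 f"
proof -
  have [measurable]: "f \<in> borel_measurable unit_itv" "\<And>n. g n \<in> borel_measurable unit_itv"
    "w \<in> borel_measurable unit_itv"
    using sq by (auto dest: square_integrable_measurable)
  have "(\<lambda>n. \<integral>x. (g n x - f x)\<^sup>2 \<partial>unit_itv) \<longlonglongrightarrow> (\<integral>x. 0 \<partial>unit_itv)"
  proof (rule integral_dominated_convergence[where w = "\<lambda>x. (w x)\<^sup>2"])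
    show "integrable unit_itv (\<lambda>x. (w x)\<^sup>2)" using sq(3) by (simp add: square_integrable_def)
    show "AE x in unit_itv. (\<lambda>n. (g n x - f x)\<^sup>2) \<longlonglongrightarrow> 0"
    proof (use lim in \<open>rule eventually_mono\<close>)
      fix x assume "(\<lambda>n. g n x) \<longlonglongrightarrow> f x"
      then have "(\<lambda>n. (g n x - f x)\<^sup>2) \<longlonglongrightarrow> (f x - f x)\<^sup>2" by (intro tendsto_intros)
      then show "(\<lambda>n. (g n x - f x)\<^sup>2) \<longlonglongrightarrow> 0" by simp
    qed
    show "AE x in unit_itv. norm ((g n x - f x)\<^sup>2) \<le> (w x)\<^sup>2" for n
      using bd[of n] by (rule eventually_mono) (simp add: abs_le_square_iff[symmetric])
  qed auto
  then have "(\<lambda>n. sqrt (\<integral>x. (g n x - f x)\<^sup>2 \<partial>unit_itv)) \<longlonglongrightarrow> sqrt 0"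
    by (intro tendsto_intros) simp
  then have "(\<lambda>n. norm (abs_L2 (g n) - abs_L2 f)) \<longlonglongrightarrow> 0"
    by (simp add: diff_abs_L2 sq norm_abs_L2 square_integrable_diff)
  then show ?thesis by (simp add: tendsto_norm_zero_iff LIM_zero_iff)
qed

lemma rat_bernstein_square_integrable: "square_integrable (rat_bernstein q)"
proof -
  have "continuous_on {0..1} (rat_bernstein q)"
    unfolding rat_bernstein_def Bernstein_def by (intro continuous_intros)
  then have "bounded (rat_bernstein q ` {0..1})"
    by (intro compact_imp_bounded compact_continuous_image) auto
  then obtain B where "\<And>x. x \<in> {0..1} \<Longrightarrow> \<bar>rat_bernstein q x\<bar> \<le> B"
    unfolding bounded_iff by (metis imageI real_norm_def)
  then show ?thesis by (intro square_integrable_bounded[where B = B]) auto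
qed

lemma L2_dense: "\<exists>d\<in>range (\<lambda>q. abs_L2 (rat_bernstein q)). dist d f < e" if e: "e > 0"
proof -
  define F where "F = fun_of f"
  have sqF: "square_integrable F" by (simp add: F_def square_integrable_fun_of)
  have [measurable]: "F \<in> borel_measurable unit_itv" by (rule square_integrable_measurable[OF sqF])
  define T where "T k x = max (- real k) (min (real k) (F x))" for k x
  have mT [measurable]: "T k \<in> borel_measurable unit_itv" for k unfolding T_def by measurable
  have Tk: "\<bar>T k x\<bar> \<le> real k" for k x by (auto simp: T_def)
  have sqT: "square_integrable (T k)" for k
    by (rule square_integrable_bounded[where B = "real k"]) (use Tk in auto)
  have "(\<lambda>k. abs_L2 (T k)) \<longlonglongrightarrow> abs_L2 F"
  proof (rule L2_tendsto_dominated[OF sqF sqT square_integrable_abs[OF sqF]])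
    show "AE x in unit_itv. (\<lambda>k. T k x) \<longlonglongrightarrow> F x"
    proof (intro AE_I2 tendsto_eventually)
      fix x
      obtain N :: nat where "\<bar>F x\<bar> \<le> real N" using real_arch_simple by blast
      then show "\<forall>\<^sub>F k in sequentially. T k x = F x"
        unfolding eventually_sequentially T_def by (intro exI[of _ N]) (auto simp: max_def min_def)
    qed
    show "AE x in unit_itv. \<bar>T k x - F x\<bar> \<le> \<bar>F x\<bar>" for k
      by (intro AE_I2) (auto simp: T_def max_def min_def)
  qed
  then obtain k where k: "dist (abs_L2 (T k)) f < e / 3"
    using e unfolding lim_sequentially F_def abs_fun_of by (metis le_refl zero_less_divide_iff zero_less_numeral)
  have "T k measurable_on {0<..<1}"
    by (subst measurable_on_iff_borel_measurable) auto
  then obtain N g where "negligible N" and g: "\<And>n. continuous_on UNIV (g n)"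
    and N: "\<And>x. x \<notin> N \<Longrightarrow> (\<lambda>n. g n x) \<longlonglongrightarrow> (if x \<in> {0<..<1} then T k x else 0)"
    unfolding measurable_on_def by blast
  define c where "c n x = max (- real k) (min (real k) (g n x))" for n x
  have cont: "continuous_on A (c n)" for A n
    unfolding c_def by (intro continuous_intros continuous_on_subset[OF g]) auto
  have ck: "\<bar>c n x\<bar> \<le> real k" for n x by (auto simp: c_def)
  have mc [measurable]: "c n \<in> borel_measurable unit_itv" for n
    by (rule continuous_imp_measurable_on_sets_lebesgue) (use cont in auto)
  have sqc: "square_integrable (c n)" for n
    by (rule square_integrable_bounded[where B = "real k"]) (use ck in auto)
  have "(\<lambda>n. abs_L2 (c n)) \<longlonglongrightarrow> abs_L2 (T k)"
  proof (rule L2_tendsto_dominated[OF sqT sqc])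
    show "square_integrable (\<lambda>x. 2 * real k)"
      by (rule square_integrable_bounded[where B = "2 * real k"]) auto
    have "AE x in unit_itv. x \<notin> N"
    proof -
      have "AE x in lebesgue. x \<notin> N"
        using \<open>negligible N\<close> by (intro AE_not_in) (simp add: negligible_iff_null_sets)
      then have "AE x in lebesgue. x \<in> {0<..<1} \<longrightarrow> x \<notin> N" by (rule eventually_mono) simp
      then show ?thesis by (subst AE_restrict_space_iff) auto
    qed
    then show "AE x in unit_itv. (\<lambda>n. c n x) \<longlonglongrightarrow> T k x"
    proof (rule AE_mp, intro AE_I2 impI)
      fix x assume "x \<in> space unit_itv" "x \<notin> N"
      then have "(\<lambda>n. g n x) \<longlonglongrightarrow> T k x" using N[of x] by simp
      then have "(\<lambda>n. c n x) \<longlonglongrightarrow> max (- real k) (min (real k) (T k x))"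
        unfolding c_def by (intro tendsto_intros)
      moreover have "max (- real k) (min (real k) (T k x)) = T k x"
        using Tk[of k x] by (auto simp: max_def min_def abs_le_iff)
      ultimately show "(\<lambda>n. c n x) \<longlonglongrightarrow> T k x" by simp
    qed
    show "AE x in unit_itv. \<bar>c n x - T k x\<bar> \<le> 2 * real k" for n
    proof (rule AE_I2)
      show "\<bar>c n x - T k x\<bar> \<le> 2 * real k" for x using ck[of n x] Tk[of k x] by linarith
    qed
  qed
  then obtain n where n: "dist (abs_L2 (c n)) (abs_L2 (T k)) < e / 3"
    using e unfolding lim_sequentially by (metis le_refl zero_less_divide_iff zero_less_numeral)
  obtain q where q: "\<And>x. 0 \<le> x \<Longrightarrow> x \<le> 1 \<Longrightarrow> \<bar>c n x - rat_bernstein q x\<bar> < e / 3"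
    using rat_bernstein_dense[OF cont, of "e/3"] e by auto
  have "dist (abs_L2 (c n)) (abs_L2 (rat_bernstein q)) \<le> e / 3"
  proof -
    have sq: "square_integrable (\<lambda>x. c n x - rat_bernstein q x)"
      by (intro square_integrable_diff sqc rat_bernstein_square_integrable)
    have "(\<integral>x. (c n x - rat_bernstein q x)\<^sup>2 \<partial>unit_itv) \<le> (\<integral>x. (e / 3)\<^sup>2 \<partial>unit_itv)"
    proof (rule integral_mono)
      show "integrable unit_itv (\<lambda>x. (e / 3)\<^sup>2)"
        using finite_measure_unit_itv by (rule finite_measure.integrable_const)
      show "(c n x - rat_bernstein q x)\<^sup>2 \<le> (e / 3)\<^sup>2" if "x \<in> space unit_itv" for x
        using q[of x] that e by (subst abs_le_square_iff[symmetric]) auto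
    qed (use sq in \<open>simp add: square_integrable_def\<close>)
    also have "\<dots> = (e / 3)\<^sup>2" by (simp add: measure_restrict_space)
    finally have "sqrt (\<integral>x. (c n x - rat_bernstein q x)\<^sup>2 \<partial>unit_itv) \<le> sqrt ((e / 3)\<^sup>2)"
      by (rule real_sqrt_le_mono)
    then show ?thesis
      using e by (simp add: dist_norm diff_abs_L2 sqc rat_bernstein_square_integrable norm_abs_L2[OF sq])
  qed
  then have "dist (abs_L2 (rat_bernstein q)) f < e"
    using k n dist_triangle[of "abs_L2 (rat_bernstein q)" f "abs_L2 (c n)"]
      dist_triangle[of "abs_L2 (c n)" f "abs_L2 (T k)"] by (simp add: dist_commute)
  then show ?thesis by blast
qed

instance L2 :: second_countable_topology
proof
  show "\<exists>B::L2 set set. countable B \<and> open = generate_topology B"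
    by (rule countable_subbasis_if_dense[of "range (\<lambda>q. abs_L2 (rat_bernstein q))"])
       (use L2_dense in auto)
qed

section \<open>Test functions and weak derivatives\<close>

definition smooth :: "(real \<Rightarrow> real) \<Rightarrow> bool" where
  "smooth f \<longleftrightarrow> (\<forall>n x. (deriv ^^ n) f field_differentiable (at x))"

definition test_functions :: "real set \<Rightarrow> (real \<Rightarrow> real) set" where
  "test_functions S =
     {\<phi>. smooth \<phi> \<and> (\<exists>K. compact K \<and> K \<subseteq> S \<and> (\<forall>x. x \<notin> K \<longrightarrow> \<phi> x = 0))}"

definition locally_integrable_on ::
    "real set \<Rightarrow> (real \<Rightarrow> 'a::{banach, second_countable_topology}) \<Rightarrow> bool" where
  "locally_integrable_on S u \<longleftrightarrow> (\<forall>K. compact K \<and> K \<subseteq> S \<longrightarrow> set_integrable lebesgue K u)"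

definition has_weak_derivative_on ::
    "(real \<Rightarrow> 'a::{banach, second_countable_topology}) \<Rightarrow> (real \<Rightarrow> 'a) \<Rightarrow> real set \<Rightarrow> bool" where
  "has_weak_derivative_on u w S \<longleftrightarrow>
     locally_integrable_on S u \<and> locally_integrable_on S w \<and>
     (\<forall>\<phi>\<in>test_functions S.
        (LINT x|lebesgue_on S. deriv \<phi> x *\<^sub>R u x) = - (LINT x|lebesgue_on S. \<phi> x *\<^sub>R w x))"

lemma smooth_coinduct:
  assumes "P f" and "\<And>g. P g \<Longrightarrow> \<exists>g'. (\<forall>x. (g has_field_derivative g' x) (at x)) \<and> P g'"
  shows "smooth f"
proof -
  have step: "(\<forall>x. g field_differentiable (at x)) \<and> P (deriv g)" if "P g" for g
  proof -
    from assms(2)[OF that] obtain g' where g': "\<And>x. (g has_field_derivative g' x) (at x)" "P g'"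
      by blast
    then have "deriv g = g'" by (auto simp: DERIV_imp_deriv)
    with g' show ?thesis by (auto simp: field_differentiable_def)
  qed
  have "P ((deriv ^^ n) f)" for n
    by (induction n) (use assms(1) step in auto)
  then show ?thesis unfolding smooth_def using step by blast
qed

lemma smooth_deriv: "smooth f \<Longrightarrow> smooth (deriv f)"
  unfolding smooth_def by (metis (no_types) funpow.simps(2) funpow_swap1 comp_apply)

lemma smooth_DERIV: "smooth f \<Longrightarrow> (f has_field_derivative deriv f x) (at x)"
  unfolding smooth_def by (metis DERIV_deriv_iff_field_differentiable funpow_0)

lemma smooth_continuous: "smooth f \<Longrightarrow> continuous_on A f"
  by (meson DERIV_isCont continuous_at_imp_continuous_on smooth_DERIV)

lemma smooth_const [simp]: "smooth (\<lambda>x. c)"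
  by (rule smooth_coinduct[of "\<lambda>f. \<exists>c. f = (\<lambda>x. c)"]) (auto intro!: derivative_eq_intros)

lemma smooth_ident [simp]: "smooth (\<lambda>x. x)"
proof (rule smooth_coinduct[of "\<lambda>f. f = (\<lambda>x. x) \<or> (\<exists>c. f = (\<lambda>x. c))"])
  fix g :: "real \<Rightarrow> real"
  assume "g = (\<lambda>x. x) \<or> (\<exists>c. g = (\<lambda>x. c))"
  then show "\<exists>g'. (\<forall>x. (g has_field_derivative g' x) (at x)) \<and>
      (g' = (\<lambda>x. x) \<or> (\<exists>c. g' = (\<lambda>x. c)))"
  proof
    assume "g = (\<lambda>x. x)"
    then show ?thesis by (intro exI[of _ "\<lambda>x. 1"]) auto
  next
    assume "\<exists>c. g = (\<lambda>x. c)"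
    then show ?thesis by (intro exI[of _ "\<lambda>x. 0"]) auto
  qed
qed simp

lemma smooth_add: assumes "smooth f" "smooth g" shows "smooth (\<lambda>x. f x + g x)"
proof (rule smooth_coinduct[of "\<lambda>h. \<exists>f g. smooth f \<and> smooth g \<and> h = (\<lambda>x. f x + g x)"])
  fix h :: "real \<Rightarrow> real"
  assume "\<exists>f g. smooth f \<and> smooth g \<and> h = (\<lambda>x. f x + g x)"
  then obtain f g where "smooth f" "smooth g" and h: "h = (\<lambda>x. f x + g x)" by blast
  then show "\<exists>h'. (\<forall>x. (h has_field_derivative h' x) (at x)) \<and>
       (\<exists>f g. smooth f \<and> smooth g \<and> h' = (\<lambda>x. f x + g x))"
    unfolding h
    by (intro exI[of _ "\<lambda>x. deriv f x + deriv g x"])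
       (auto intro!: DERIV_add smooth_DERIV intro: smooth_deriv)
qed (use assms in auto)

inductive smooth_ring :: "(real \<Rightarrow> real) \<Rightarrow> bool" where
  "smooth f \<Longrightarrow> smooth g \<Longrightarrow> smooth_ring (\<lambda>x. f x * g x)"
| "smooth_ring f \<Longrightarrow> smooth_ring g \<Longrightarrow> smooth_ring (\<lambda>x. f x + g x)"

lemma smooth_mult: assumes "smooth f" "smooth g" shows "smooth (\<lambda>x. f x * g x)"
proof (rule smooth_coinduct[of smooth_ring])
  show "\<exists>h'. (\<forall>x. (h has_field_derivative h' x) (at x)) \<and> smooth_ring h'" if "smooth_ring h" for h
    using that
  proof induction
    case (1 f g)
    then show ?case
      by (intro exI[of _ "\<lambda>x. deriv f x * g x + f x * deriv g x"] conjI allI smooth_ring.intros smooth_deriv)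
         (auto intro!: derivative_eq_intros smooth_DERIV)
  next
    case (2 f g)
    then obtain f' g' where "\<And>x. (f has_field_derivative f' x) (at x)" "smooth_ring f'"
      "\<And>x. (g has_field_derivative g' x) (at x)" "smooth_ring g'" by blast
    then show ?case
      by (intro exI[of _ "\<lambda>x. f' x + g' x"] conjI allI smooth_ring.intros DERIV_add) auto
  qed
qed (use assms in \<open>auto intro: smooth_ring.intros\<close>)

lemma smooth_power: "smooth f \<Longrightarrow> smooth (\<lambda>x. f x ^ n)"
  by (induction n) (auto intro: smooth_mult)

lemma smooth_sum: "(\<And>i. i \<in> I \<Longrightarrow> smooth (f i)) \<Longrightarrow> smooth (\<lambda>x. \<Sum>i\<in>I. f i x)"
  by (induction I rule: infinite_finite_induct) (auto intro: smooth_add)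

lemma smooth_affine: assumes "smooth f" shows "smooth (\<lambda>x. f (a * x + b))"
proof (rule smooth_coinduct[of "\<lambda>h. \<exists>c f. smooth f \<and> h = (\<lambda>x. c * f (a * x + b))"])
  show "\<exists>c g. smooth g \<and> (\<lambda>x. f (a * x + b)) = (\<lambda>x. c * g (a * x + b))"
    using assms by (intro exI[of _ 1] exI[of _ f]) auto
  fix h :: "real \<Rightarrow> real"
  assume "\<exists>c f. smooth f \<and> h = (\<lambda>x. c * f (a * x + b))"
  then obtain c f where f: "smooth f" and h: "h = (\<lambda>x. c * f (a * x + b))" by blast
  have "(h has_field_derivative (c * a) * deriv f (a * x + b)) (at x)" for x
    unfolding h by (auto intro!: derivative_eq_intros DERIV_chain2[OF smooth_DERIV[OF f]])
  then show "\<exists>h'. (\<forall>x. (h has_field_derivative h' x) (at x)) \<and>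
       (\<exists>c f. smooth f \<and> h' = (\<lambda>x. c * f (a * x + b)))"
    using smooth_deriv[OF f] by (intro exI[of _ "\<lambda>x. (c * a) * deriv f (a * x + b)"]) blast
qed

lemma poly_exp_tendsto_0: "((\<lambda>y::real. poly p y * exp (- y)) \<longlongrightarrow> 0) at_top"
proof -
  have "((\<lambda>y::real. \<Sum>i\<le>degree p. coeff p i * (y ^ i / exp y)) \<longlongrightarrow> (\<Sum>i\<le>degree p. coeff p i * 0)) at_top"
    by (intro tendsto_sum tendsto_mult tendsto_const tendsto_power_div_exp_0)
  then show ?thesis
    by (simp add: poly_altdef exp_minus sum_distrib_right divide_inverse mult.assoc)
qed

definition flat :: "real poly \<Rightarrow> real \<Rightarrow> real" where
  "flat p x = (if x \<le> 0 then 0 else poly p (inverse x) * exp (- inverse x))"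

lemma flat_DERIV: "(flat p has_field_derivative flat (p * [:0, 0, 1:] - pderiv p * [:0, 0, 1:]) x) (at x)"
proof -
  consider "x < 0" | "x = 0" | "x > 0" by linarith
  then show ?thesis
  proof cases
    case 1
    have "(flat p has_field_derivative 0) (at x)"
      by (rule has_field_derivative_transform_within_open[of "\<lambda>x. 0" _ _ "{..<0}"])
         (use 1 in \<open>auto simp: flat_def\<close>)
    then show ?thesis using 1 by (simp add: flat_def)
  next
    case 2
    have "((\<lambda>h. flat p h / h) \<longlongrightarrow> 0) (at 0)"
    proof (rule filterlim_split_at)
      show "((\<lambda>h. flat p h / h) \<longlongrightarrow> 0) (at_left 0)"
        by (rule tendsto_eventually)
           (auto simp: flat_def eventually_at_filter)
      have "((\<lambda>h. poly (p * [:0, 1:]) (inverse h) * exp (- inverse h)) \<longlongrightarrow> 0) (at_right 0)"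
        by (rule filterlim_compose[OF poly_exp_tendsto_0 filterlim_inverse_at_top_right])
      then show "((\<lambda>h. flat p h / h) \<longlongrightarrow> 0) (at_right 0)"
        by (rule Lim_transform_eventually)
           (auto simp: flat_def eventually_at_filter divide_inverse)
    qed
    then show ?thesis using 2 by (simp add: DERIV_def flat_def)
  next
    case 3
    have "((\<lambda>x. poly p (inverse x) * exp (- inverse x)) has_field_derivative
        poly (pderiv p) (inverse x) * (- (inverse x)\<^sup>2) * exp (- inverse x)
         + poly p (inverse x) * (exp (- inverse x) * (inverse x)\<^sup>2)) (at x)"
      using 3 by (auto intro!: derivative_eq_intros DERIV_chain2[OF poly_DERIV] simp: power2_eq_square)
    then have "(flat p has_field_derivative
        poly (pderiv p) (inverse x) * (- (inverse x)\<^sup>2) * exp (- inverse x)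
         + poly p (inverse x) * (exp (- inverse x) * (inverse x)\<^sup>2)) (at x)"
      by (rule has_field_derivative_transform_within_open[of _ _ _ "{0<..}"])
         (use 3 in \<open>auto simp: flat_def\<close>)
    then show ?thesis using 3 by (simp add: flat_def algebra_simps power2_eq_square)
  qed
qed

lemma smooth_flat: "smooth (flat p)"
  by (rule smooth_coinduct[of "\<lambda>f. \<exists>p. f = flat p"]) (use flat_DERIV in blast)+

definition cutoff :: "nat \<Rightarrow> real \<Rightarrow> real" where
  "cutoff n x = flat 1 (real (Suc n) * x + (- 1)) * flat 1 (- real (Suc n) * x + (real (Suc n) - 1))"

lemma smooth_cutoff: "smooth (cutoff n)"
  unfolding cutoff_def by (intro smooth_mult smooth_affine smooth_flat)

lemma cutoff_bounds: "0 \<le> cutoff n x" "cutoff n x \<le> 1"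
proof -
  have flat: "0 \<le> flat 1 y" "flat 1 y \<le> 1" for y by (auto simp: flat_def)
  show "0 \<le> cutoff n x" "cutoff n x \<le> 1"
    unfolding cutoff_def using flat by (auto intro: mult_le_one)
qed

lemma cutoff_support:
  assumes "x \<notin> {1 / Suc n..1 - 1 / Suc n}" shows "cutoff n x = 0"
proof -
  have "x < 1 / Suc n \<or> 1 - x < 1 / Suc n" using assms by auto
  then have "real (Suc n) * x < 1 \<or> real (Suc n) * (1 - x) < 1"
    by (simp add: pos_less_divide_eq mult.commute)
  then have *: "c * x + (- 1) \<le> 0 \<or> - c * x + (c - 1) \<le> 0" if "c = real (Suc n)" for c
    unfolding that[symmetric] by (auto simp: right_diff_distrib)
  show ?thesis
    using *[OF refl]
    by (elim disjE) (simp_all only: cutoff_def flat_def if_True mult_zero_left mult_zero_right)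
qed

lemma cutoff_tendsto:
  assumes "0 < x" "x < 1" shows "(\<lambda>n. cutoff n x) \<longlonglongrightarrow> 1"
proof -
  have flat: "((\<lambda>y. flat 1 y) \<longlongrightarrow> 1) at_top"
  proof -
    have "((\<lambda>y::real. exp (- inverse y)) \<longlongrightarrow> exp (- 0)) at_top"
      by (intro tendsto_intros tendsto_inverse_0_at_top filterlim_ident)
    moreover have "\<forall>\<^sub>F y in at_top. exp (- inverse y) = flat 1 y"
      using eventually_gt_at_top[of 0] by (rule eventually_mono) (simp add: flat_def)
    ultimately have "(flat 1 \<longlongrightarrow> exp (- 0)) at_top"
      by (rule Lim_transform_eventually)
    then show ?thesis by simp
  qed
  have *: "filterlim (\<lambda>n. real (Suc n) * y + c) at_top sequentially" if "y > 0" for y c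
  proof -
    have "filterlim (\<lambda>n. y * real (Suc n)) at_top sequentially"
      by (rule filterlim_tendsto_pos_mult_at_top[OF tendsto_const that])
         (rule filterlim_compose[OF filterlim_real_sequentially filterlim_Suc])
    then show ?thesis
      using filterlim_tendsto_add_at_top[OF tendsto_const[of c]] by (simp add: add.commute mult.commute)
  qed
  have "(\<lambda>n. flat 1 (real (Suc n) * x + (- 1)) * flat 1 (real (Suc n) * (1 - x) + (- 1))) \<longlonglongrightarrow> 1 * 1"
    by (intro tendsto_mult filterlim_compose[OF flat] *) (use assms in auto)
  then show ?thesis unfolding cutoff_def by (simp add: algebra_simps)
qed

lemma test_functions_deriv:
  assumes "\<phi> \<in> test_functions S" shows "deriv \<phi> \<in> test_functions S"
proof -
  obtain K where \<phi>: "smooth \<phi>" and K: "compact K" "K \<subseteq> S" "\<And>x. x \<notin> K \<Longrightarrow> \<phi> x = 0"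
    using assms by (auto simp: test_functions_def)
  have "deriv \<phi> x = 0" if "x \<notin> K" for x
  proof (rule DERIV_imp_deriv)
    show "(\<phi> has_field_derivative 0) (at x)"
      by (rule has_field_derivative_transform_within_open[of "\<lambda>x. 0" _ _ "- K"])
         (use K that in \<open>auto intro: compact_imp_closed\<close>)
  qed
  then show ?thesis
    using K \<phi> unfolding test_functions_def by (auto intro: smooth_deriv)
qed

lemma smooth_square_integrable:
  assumes "smooth f" shows "square_integrable f"
proof -
  have "bounded (f ` {0..1})"
    by (intro compact_imp_bounded compact_continuous_image smooth_continuous assms) auto
  then obtain B where "\<And>x. x \<in> {0..1} \<Longrightarrow> \<bar>f x\<bar> \<le> B"
    unfolding bounded_iff by (metis imageI real_norm_def)
  moreover have "f \<in> borel_measurable unit_itv"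
    by (rule continuous_imp_measurable_on_sets_lebesgue) (use assms smooth_continuous in auto)
  ultimately show ?thesis by (intro square_integrable_bounded[where B = B]) auto
qed

lemma test_function_smooth: "\<phi> \<in> test_functions S \<Longrightarrow> smooth \<phi>"
  by (simp add: test_functions_def)

lemma test_functions_dense:
  assumes "\<And>\<phi>. \<phi> \<in> test_functions {0<..<1} \<Longrightarrow> inner v (abs_L2 \<phi>) = 0"
  shows "v = 0"
proof -
  have rb: "smooth (rat_bernstein q)" for q
    unfolding rat_bernstein_def Bernstein_def
    by (intro smooth_sum smooth_mult smooth_const smooth_power smooth_ident)
       (use smooth_add[OF smooth_const[of 1] smooth_mult[OF smooth_const[of "-1"] smooth_ident]] in auto)
  have 0: "inner v (abs_L2 (rat_bernstein q)) = 0" for q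
  proof -
    let ?g = "\<lambda>n x. rat_bernstein q x * cutoff n x"
    have sm: "smooth (?g n)" for n by (intro smooth_mult rb smooth_cutoff)
    have "?g n \<in> test_functions {0<..<1}" for n
    proof -
      have "0 < 1 / real (Suc n)" by simp
      then have "{1 / Suc n..1 - 1 / Suc n} \<subseteq> {0<..<1}"
        unfolding subset_iff atLeastAtMost_iff greaterThanLessThan_iff by linarith
      moreover have "?g n x = 0" if "x \<notin> {1 / Suc n..1 - 1 / Suc n}" for x
        using cutoff_support[OF that] by simp
      ultimately show ?thesis
        unfolding test_functions_def using sm[of n] compact_Icc by blast
    qed
    then have "inner v (abs_L2 (?g n)) = 0" for n by (rule assms)
    moreover have "(\<lambda>n. abs_L2 (?g n)) \<longlonglongrightarrow> abs_L2 (rat_bernstein q)"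
    proof (rule L2_tendsto_dominated)
      show "square_integrable (rat_bernstein q)" "square_integrable (\<lambda>x. \<bar>rat_bernstein q x\<bar>)"
        "square_integrable (?g n)" for n
        by (auto intro: smooth_square_integrable rb sm square_integrable_abs)
      have "(\<lambda>n. ?g n x) \<longlonglongrightarrow> rat_bernstein q x * 1" if "x \<in> space unit_itv" for x
        using that by (intro tendsto_intros cutoff_tendsto) auto
      then show "AE x in unit_itv. (\<lambda>n. ?g n x) \<longlonglongrightarrow> rat_bernstein q x" by (intro AE_I2) simp
      have "\<bar>?g n x - rat_bernstein q x\<bar> \<le> \<bar>rat_bernstein q x\<bar>" for n x
      proof -
        have "\<bar>?g n x - rat_bernstein q x\<bar> = \<bar>rat_bernstein q x\<bar> * \<bar>cutoff n x - 1\<bar>"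
          by (simp add: abs_mult[symmetric] algebra_simps)
        also have "\<dots> \<le> \<bar>rat_bernstein q x\<bar> * 1"
          using cutoff_bounds[of n x] by (intro mult_left_mono) auto
        finally show ?thesis by simp
      qed
      then show "AE x in unit_itv. \<bar>?g n x - rat_bernstein q x\<bar> \<le> \<bar>rat_bernstein q x\<bar>" for n by simp
    qed
    then have "(\<lambda>n. inner v (abs_L2 (?g n))) \<longlonglongrightarrow> inner v (abs_L2 (rat_bernstein q))"
      by (rule tendsto_inner[OF tendsto_const])
    ultimately show ?thesis by (simp add: LIMSEQ_const_iff)
  qed
  show ?thesis
  proof (rule ccontr)
    assume "v \<noteq> 0"
    then obtain q where q: "dist (abs_L2 (rat_bernstein q)) v < norm v"
      using L2_dense[of "norm v" v] by auto
    have "norm v * norm v = inner v (v - abs_L2 (rat_bernstein q))"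
      using 0[of q] by (simp add: inner_diff_right norm_eq_sqrt_inner)
    also have "\<dots> \<le> norm v * norm (v - abs_L2 (rat_bernstein q))" by (rule norm_cauchy_schwarz)
    also have "\<dots> < norm v * norm v"
      using q \<open>v \<noteq> 0\<close> by (intro mult_strict_left_mono) (auto simp: dist_norm norm_minus_commute)
    finally show False by simp
  qed
qed

section \<open>Sobolev spaces on the unit interval\<close>

definition has_weak_deriv :: "L2 \<Rightarrow> L2 \<Rightarrow> bool" where
  "has_weak_deriv u v \<longleftrightarrow> has_weak_derivative_on (fun_of u) (fun_of v) {0<..<1}"

text \<open>Well defined by uniqueness of weak derivatives, lemma \<open>has_weak_deriv_unique\<close> below.\<close>

definition weak_deriv :: "L2 \<Rightarrow> L2" where
  "weak_deriv u = (THE v. has_weak_deriv u v)"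

definition W12 :: "L2 set" where
  "W12 = {u. \<exists>v. has_weak_deriv u v}"

definition W22 :: "L2 set" where
  "W22 = {u \<in> W12. weak_deriv u \<in> W12}"

text \<open>The closure of the test functions in the norm of $W^{1,2}(0,1)$.\<close>

definition W12_0 :: "L2 set" where
  "W12_0 = {u \<in> W12. \<exists>\<phi>. (\<forall>n. \<phi> n \<in> test_functions {0<..<1}) \<and>
     (\<lambda>n. abs_L2 (\<phi> n)) \<longlonglongrightarrow> u \<and> (\<lambda>n. abs_L2 (deriv (\<phi> n))) \<longlonglongrightarrow> weak_deriv u}"

lemma locally_integrable_fun_of: "locally_integrable_on {0<..<1} (fun_of u)"
  unfolding locally_integrable_on_def
proof (intro allI impI)
  fix K :: "real set" assume K: "compact K \<and> K \<subseteq> {0<..<1}"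
  have "integrable unit_itv (fun_of u)"
    by (rule square_integrable_integrable[OF square_integrable_fun_of])
  then have "set_integrable lebesgue {0<..<1} (fun_of u)"
    by (simp add: set_integrable_def integrable_restrict_space)
  then show "set_integrable lebesgue K (fun_of u)"
    by (rule set_integrable_subset) (use K in \<open>auto intro: lmeasurable_compact fmeasurableD\<close>)
qed

lemma inner_L2_fun_of:
  assumes "square_integrable f"
  shows "(LINT x|unit_itv. f x * fun_of u x) = inner u (abs_L2 f)"
  using inner_abs_L2[OF assms square_integrable_fun_of[of u]] by (simp add: abs_fun_of inner_commute)

lemma test_functions_square_integrable: "\<phi> \<in> test_functions S \<Longrightarrow> square_integrable \<phi>"
  by (blast intro: smooth_square_integrable test_function_smooth)

lemma has_weak_deriv_iff:
  "has_weak_deriv u v \<longleftrightarrow>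
     (\<forall>\<phi>\<in>test_functions {0<..<1}. inner u (abs_L2 (deriv \<phi>)) = - inner v (abs_L2 \<phi>))"
proof -
  have "(LINT x|unit_itv. \<phi> x *\<^sub>R fun_of v x) = inner v (abs_L2 \<phi>)"
    "(LINT x|unit_itv. deriv \<phi> x *\<^sub>R fun_of u x) = inner u (abs_L2 (deriv \<phi>))"
    if "\<phi> \<in> test_functions {0<..<1}" for \<phi>
    using inner_L2_fun_of[OF test_functions_square_integrable[OF that]]
      inner_L2_fun_of[OF test_functions_square_integrable[OF test_functions_deriv[OF that]]] by auto
  then show ?thesis
    unfolding has_weak_deriv_def has_weak_derivative_on_def by (simp add: locally_integrable_fun_of)
qed

lemma has_weak_deriv_unique:
  assumes "has_weak_deriv u v" "has_weak_deriv u w" shows "v = w"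
proof -
  have "v - w = 0"
    by (rule test_functions_dense) (use assms in \<open>simp add: has_weak_deriv_iff inner_diff_left\<close>)
  then show ?thesis by simp
qed

lemma weak_deriv_eqI: "has_weak_deriv u v \<Longrightarrow> weak_deriv u = v"
  unfolding weak_deriv_def by (blast intro: has_weak_deriv_unique)

lemma W12_has_weak_deriv: "u \<in> W12 \<Longrightarrow> has_weak_deriv u (weak_deriv u)"
  by (auto simp: W12_def weak_deriv_eqI)

lemma has_weak_deriv_add:
  "has_weak_deriv u v \<Longrightarrow> has_weak_deriv u' v' \<Longrightarrow> has_weak_deriv (u + u') (v + v')"
  by (simp add: has_weak_deriv_iff inner_add_left)

lemma has_weak_deriv_scaleR: "has_weak_deriv u v \<Longrightarrow> has_weak_deriv (c *\<^sub>R u) (c *\<^sub>R v)"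
  by (simp add: has_weak_deriv_iff)

lemma W12_add: "u \<in> W12 \<Longrightarrow> v \<in> W12 \<Longrightarrow> u + v \<in> W12"
  unfolding W12_def by (blast intro: has_weak_deriv_add)

lemma W12_scaleR: "u \<in> W12 \<Longrightarrow> c *\<^sub>R u \<in> W12"
  unfolding W12_def by (blast intro: has_weak_deriv_scaleR)

lemma weak_deriv_add: "u \<in> W12 \<Longrightarrow> v \<in> W12 \<Longrightarrow> weak_deriv (u + v) = weak_deriv u + weak_deriv v"
  by (intro weak_deriv_eqI has_weak_deriv_add W12_has_weak_deriv)

lemma weak_deriv_scaleR: "u \<in> W12 \<Longrightarrow> weak_deriv (c *\<^sub>R u) = c *\<^sub>R weak_deriv u"
  by (intro weak_deriv_eqI has_weak_deriv_scaleR W12_has_weak_deriv)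

lemma W22_add: "u \<in> W22 \<Longrightarrow> v \<in> W22 \<Longrightarrow> u + v \<in> W22"
  by (simp add: W22_def W12_add weak_deriv_add)

lemma W22_scaleR: "u \<in> W22 \<Longrightarrow> c *\<^sub>R u \<in> W22"
  by (simp add: W22_def W12_scaleR weak_deriv_scaleR)

lemma test_functions_add:
  assumes "\<phi> \<in> test_functions S" "\<psi> \<in> test_functions S"
  shows "(\<lambda>x. \<phi> x + \<psi> x) \<in> test_functions S"
proof -
  obtain K L where "compact K" "K \<subseteq> S" "\<And>x. x \<notin> K \<Longrightarrow> \<phi> x = 0"
    and "compact L" "L \<subseteq> S" "\<And>x. x \<notin> L \<Longrightarrow> \<psi> x = 0"
    using assms by (auto simp: test_functions_def)
  then have "compact (K \<union> L) \<and> K \<union> L \<subseteq> S \<and> (\<forall>x. x \<notin> K \<union> L \<longrightarrow> \<phi> x + \<psi> x = 0)" by auto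
  then show ?thesis
    using assms smooth_add unfolding test_functions_def by blast
qed

lemma test_functions_scale:
  assumes "\<phi> \<in> test_functions S" shows "(\<lambda>x. c * \<phi> x) \<in> test_functions S"
proof -
  obtain K where "compact K" "K \<subseteq> S" "\<And>x. x \<notin> K \<Longrightarrow> \<phi> x = 0"
    using assms by (auto simp: test_functions_def)
  then have "compact K \<and> K \<subseteq> S \<and> (\<forall>x. x \<notin> K \<longrightarrow> c * \<phi> x = 0)" by auto
  then show ?thesis
    using assms smooth_mult[OF smooth_const[of c]] unfolding test_functions_def by blast
qed

lemma W12_0_add:
  assumes "u \<in> W12_0" "v \<in> W12_0" shows "u + v \<in> W12_0"
proof -
  obtain \<phi> \<psi> where uv: "u \<in> W12" "v \<in> W12"
    and \<phi>: "\<And>n. \<phi> n \<in> test_functions {0<..<1}" "(\<lambda>n. abs_L2 (\<phi> n)) \<longlonglongrightarrow> u"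
      "(\<lambda>n. abs_L2 (deriv (\<phi> n))) \<longlonglongrightarrow> weak_deriv u"
    and \<psi>: "\<And>n. \<psi> n \<in> test_functions {0<..<1}" "(\<lambda>n. abs_L2 (\<psi> n)) \<longlonglongrightarrow> v"
      "(\<lambda>n. abs_L2 (deriv (\<psi> n))) \<longlonglongrightarrow> weak_deriv v"
    using assms unfolding W12_0_def by blast
  have sq: "square_integrable (\<phi> n)" "square_integrable (\<psi> n)"
    "square_integrable (deriv (\<phi> n))" "square_integrable (deriv (\<psi> n))" for n
    by (auto intro: test_functions_square_integrable test_functions_deriv \<phi>(1) \<psi>(1))
  have d: "deriv (\<lambda>x. \<phi> n x + \<psi> n x) = (\<lambda>x. deriv (\<phi> n) x + deriv (\<psi> n) x)" for n
    by (intro ext DERIV_imp_deriv DERIV_add smooth_DERIV test_function_smooth[OF \<phi>(1)] test_function_smooth[OF \<psi>(1)])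
  have "abs_L2 (\<lambda>x. \<phi> n x + \<psi> n x) = abs_L2 (\<phi> n) + abs_L2 (\<psi> n)"
    "abs_L2 (deriv (\<lambda>x. \<phi> n x + \<psi> n x)) = abs_L2 (deriv (\<phi> n)) + abs_L2 (deriv (\<psi> n))" for n
    unfolding d using sq by (simp_all add: plus_L2.abs_eq)
  then have "(\<lambda>n. abs_L2 (\<lambda>x. \<phi> n x + \<psi> n x)) \<longlonglongrightarrow> u + v"
    "(\<lambda>n. abs_L2 (deriv (\<lambda>x. \<phi> n x + \<psi> n x))) \<longlonglongrightarrow> weak_deriv (u + v)"
    by (auto simp: weak_deriv_add uv intro!: tendsto_add \<phi> \<psi>)
  then show ?thesis
    unfolding W12_0_def using W12_add[OF uv] test_functions_add[OF \<phi>(1) \<psi>(1)]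
    by (intro CollectI conjI exI[of _ "\<lambda>n x. \<phi> n x + \<psi> n x"] allI)
qed

lemma W12_0_scaleR:
  assumes "u \<in> W12_0" shows "c *\<^sub>R u \<in> W12_0"
proof -
  obtain \<phi> where u: "u \<in> W12"
    and \<phi>: "\<And>n. \<phi> n \<in> test_functions {0<..<1}" "(\<lambda>n. abs_L2 (\<phi> n)) \<longlonglongrightarrow> u"
      "(\<lambda>n. abs_L2 (deriv (\<phi> n))) \<longlonglongrightarrow> weak_deriv u"
    using assms unfolding W12_0_def by blast
  have sq: "square_integrable (\<phi> n)" "square_integrable (deriv (\<phi> n))" for n
    by (auto intro: test_functions_square_integrable test_functions_deriv \<phi>(1))
  have d: "deriv (\<lambda>x. c * \<phi> n x) = (\<lambda>x. c * deriv (\<phi> n) x)" for n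
    by (intro ext DERIV_imp_deriv DERIV_cmult smooth_DERIV test_function_smooth[OF \<phi>(1)])
  have "abs_L2 (\<lambda>x. c * \<phi> n x) = c *\<^sub>R abs_L2 (\<phi> n)"
    "abs_L2 (deriv (\<lambda>x. c * \<phi> n x)) = c *\<^sub>R abs_L2 (deriv (\<phi> n))" for n
    unfolding d using sq by (simp_all add: scaleR_L2.abs_eq)
  then have "(\<lambda>n. abs_L2 (\<lambda>x. c * \<phi> n x)) \<longlonglongrightarrow> c *\<^sub>R u"
    "(\<lambda>n. abs_L2 (deriv (\<lambda>x. c * \<phi> n x))) \<longlonglongrightarrow> weak_deriv (c *\<^sub>R u)"
    by (auto simp: weak_deriv_scaleR u intro!: tendsto_scaleR \<phi>)
  then show ?thesis
    unfolding W12_0_def using W12_scaleR[OF u] test_functions_scale[OF \<phi>(1)]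
    by (intro CollectI conjI exI[of _ "\<lambda>n x. c * \<phi> n x"] allI)
qed

lemma poincare_test_function:
  assumes "\<phi> \<in> test_functions {0<..<1}"
  shows "norm (abs_L2 \<phi>) \<le> 2 * norm (abs_L2 (deriv \<phi>))"
proof -
  have sm: "smooth \<phi>" "smooth (deriv \<phi>)"
    using assms by (auto intro: test_function_smooth smooth_deriv)
  have end1: "\<phi> 1 = 0"
    using assms by (force simp: test_functions_def)
  define \<psi> where "\<psi> x = 2 * x * deriv \<phi> x" for x
  have smx: "smooth \<psi>"
    unfolding \<psi>_def by (intro smooth_mult smooth_const smooth_ident sm)
  have sq: "square_integrable \<phi>" "square_integrable (deriv \<phi>)" "square_integrable \<psi>"
    by (auto intro: smooth_square_integrable sm smx)
  have "((\<lambda>x. (\<phi> x)\<^sup>2 + \<phi> x * \<psi> x) has_integral 1 * (\<phi> 1)\<^sup>2 - 0 * (\<phi> 0)\<^sup>2) {0..1}"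
  proof (rule fundamental_theorem_of_calculus)
    fix x :: real
    have "((\<lambda>x. x * (\<phi> x)\<^sup>2) has_field_derivative
        1 * (\<phi> x)\<^sup>2 + (of_nat 2 * (deriv \<phi> x * \<phi> x ^ (2 - Suc 0))) * x) (at x)"
      by (intro DERIV_mult DERIV_ident DERIV_power smooth_DERIV[OF sm(1)])
    then have "((\<lambda>x. x * (\<phi> x)\<^sup>2) has_field_derivative (\<phi> x)\<^sup>2 + \<phi> x * \<psi> x) (at x)"
      by (simp add: \<psi>_def mult_ac)
    then show "((\<lambda>x. x * (\<phi> x)\<^sup>2) has_vector_derivative (\<phi> x)\<^sup>2 + \<phi> x * \<psi> x) (at x within {0..1})"
      unfolding has_real_derivative_iff_has_vector_derivative[symmetric]
      by (rule has_field_derivative_at_within)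
  qed simp
  then have "integral {0<..<1} (\<lambda>x. (\<phi> x)\<^sup>2 + \<phi> x * \<psi> x) = 0"
    unfolding integral_open_interval_real[symmetric] by (simp add: end1 integral_unique)
  moreover have "integrable unit_itv (\<lambda>x. (\<phi> x)\<^sup>2 + \<phi> x * \<psi> x)"
    using sq square_integrable_mult by (auto simp: power2_eq_square)
  ultimately have "(\<integral>x. (\<phi> x)\<^sup>2 + \<phi> x * \<psi> x \<partial>unit_itv) = 0"
    by (simp add: lebesgue_integral_eq_integral)
  then have "inner (abs_L2 \<phi>) (abs_L2 \<phi>) + inner (abs_L2 \<phi>) (abs_L2 \<psi>) = 0"
    using sq square_integrable_mult[OF sq(1) sq(1)] square_integrable_mult[OF sq(1) sq(3)]
    by (simp add: inner_abs_L2 power2_eq_square)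
  then have "norm (abs_L2 \<phi>) * norm (abs_L2 \<phi>) = inner (abs_L2 \<phi>) (- abs_L2 \<psi>)"
    by (simp add: norm_eq_sqrt_inner)
  also have "\<dots> \<le> norm (abs_L2 \<phi>) * norm (- abs_L2 \<psi>)" by (rule norm_cauchy_schwarz)
  finally have "norm (abs_L2 \<phi>) \<le> norm (abs_L2 \<psi>)"
    by (cases "norm (abs_L2 \<phi>) = 0") (simp_all add: mult_le_cancel_left)
  also have "norm (abs_L2 \<psi>) \<le> norm (abs_L2 (\<lambda>x. 2 * deriv \<phi> x))"
  proof -
    have sq2: "square_integrable (\<lambda>x. 2 * deriv \<phi> x)" by (rule square_integrable_scale[OF sq(2)])
    have "(\<integral>x. (\<psi> x)\<^sup>2 \<partial>unit_itv) \<le> (\<integral>x. (2 * deriv \<phi> x)\<^sup>2 \<partial>unit_itv)"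
    proof (rule integral_mono)
      show "(\<psi> x)\<^sup>2 \<le> (2 * deriv \<phi> x)\<^sup>2" if "x \<in> space unit_itv" for x
      proof -
        have "\<bar>x\<bar> * \<bar>2 * deriv \<phi> x\<bar> \<le> 1 * \<bar>2 * deriv \<phi> x\<bar>"
          using that by (intro mult_right_mono) auto
        then show ?thesis
          unfolding abs_le_square_iff[symmetric] \<psi>_def by (simp add: abs_mult mult_ac)
      qed
    qed (use sq sq2 in \<open>auto simp: square_integrable_def\<close>)
    then show ?thesis by (simp add: norm_abs_L2 sq sq2)
  qed
  also have "abs_L2 (\<lambda>x. 2 * deriv \<phi> x) = 2 *\<^sub>R abs_L2 (deriv \<phi>)"
    using sq by (simp add: scaleR_L2.abs_eq)
  finally show ?thesis by simp
qed

lemma zero_weak_deriv2: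
  assumes "u \<in> W22" "u \<in> W12_0" "weak_deriv (weak_deriv u) = 0"
  shows "u = 0"
proof -
  let ?v = "weak_deriv u"
  obtain \<phi> where \<phi>: "\<And>n. \<phi> n \<in> test_functions {0<..<1}" "(\<lambda>n. abs_L2 (\<phi> n)) \<longlonglongrightarrow> u"
      "(\<lambda>n. abs_L2 (deriv (\<phi> n))) \<longlonglongrightarrow> ?v"
    using assms(2) unfolding W12_0_def by blast
  have "has_weak_deriv ?v 0"
    using assms W12_has_weak_deriv[of ?v] by (simp add: W22_def)
  then have "inner ?v (abs_L2 (deriv (\<phi> n))) = 0" for n
    using \<phi>(1) by (simp add: has_weak_deriv_iff)
  moreover have "(\<lambda>n. inner ?v (abs_L2 (deriv (\<phi> n)))) \<longlonglongrightarrow> inner ?v ?v"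
    by (rule tendsto_inner[OF tendsto_const \<phi>(3)])
  ultimately have "?v = 0" by (simp add: LIMSEQ_const_iff)
  have "norm u \<le> 2 * norm ?v"
    by (rule tendsto_le[OF _ tendsto_mult[OF tendsto_const tendsto_norm[OF \<phi>(3)]] tendsto_norm[OF \<phi>(2)]])
       (auto intro!: always_eventually poincare_test_function \<phi>(1))
  then show ?thesis using \<open>?v = 0\<close> by simp
qed

lemma weak_deriv_zero: "weak_deriv 0 = 0"
  by (rule weak_deriv_eqI) (simp add: has_weak_deriv_iff)

lemma zero_mem_spaces: "0 \<in> W22 \<inter> W12_0"
proof -
  have W12: "0 \<in> W12"
    unfolding W12_def by (rule CollectI, rule exI[of _ 0]) (simp add: has_weak_deriv_iff)
  have t: "(\<lambda>x. 0) \<in> test_functions {0<..<1}"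
    unfolding test_functions_def by (rule CollectI, rule conjI[OF smooth_const], rule exI[of _ "{}"]) simp
  have d: "deriv (\<lambda>x::real. 0::real) = (\<lambda>x. 0)"
    by (rule ext) (rule DERIV_imp_deriv, rule DERIV_const)
  have "0 \<in> W12_0"
    unfolding W12_0_def
    by (rule CollectI, rule conjI[OF W12], rule exI[of _ "\<lambda>n x. 0"])
       (simp only: t d weak_deriv_zero zero_L2.abs_eq[symmetric] tendsto_const simp_thms)
  moreover have "0 \<in> W22"
    unfolding W22_def by (simp only: mem_Collect_eq weak_deriv_zero W12 simp_thms)
  ultimately show ?thesis by (rule IntI[rotated])
qed

text \<open>
  The energy space $W^{2,2}(0,1) \cap W^{1,2}_0(0,1)$. Its norm is $\|u''\|_{L^2}$, which is
  definite by the Poincare inequality; \<open>to_L2\<close> is the (non-isometric) embedding into $L^2(0,1)$.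
\<close>

typedef navier_space = "W22 \<inter> W12_0"
  morphisms to_L2 Abs_navier_space
  using zero_mem_spaces by blast

setup_lifting type_definition_navier_space

definition second_deriv :: "navier_space \<Rightarrow> L2" where
  "second_deriv u = weak_deriv (weak_deriv (to_L2 u))"

lemma to_L2_eq_0:
  assumes "norm (second_deriv u) = 0" shows "to_L2 u = 0"
proof (rule zero_weak_deriv2)
  show "to_L2 u \<in> W22" using to_L2[of u] by (rule IntD1)
  show "to_L2 u \<in> W12_0" using to_L2[of u] by (rule IntD2)
  have "second_deriv u = 0" using assms by (rule norm_eq_zero[THEN iffD1])
  then show "weak_deriv (weak_deriv (to_L2 u)) = 0" unfolding second_deriv_def .
qed

instantiation navier_space :: real_normed_vector
begin

lift_definition zero_navier_space :: navier_space is 0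
  by (rule zero_mem_spaces)

lift_definition plus_navier_space :: "navier_space \<Rightarrow> navier_space \<Rightarrow> navier_space" is "(+)"
  by (auto intro: W22_add W12_0_add)

lift_definition scaleR_navier_space :: "real \<Rightarrow> navier_space \<Rightarrow> navier_space" is "(*\<^sub>R)"
  by (auto intro: W22_scaleR W12_0_scaleR)

lift_definition uminus_navier_space :: "navier_space \<Rightarrow> navier_space" is uminus
proof -
  fix u assume "u \<in> W22 \<inter> W12_0"
  then have "(-1) *\<^sub>R u \<in> W22 \<inter> W12_0"
    by (intro IntI W22_scaleR W12_0_scaleR) auto
  then show "- u \<in> W22 \<inter> W12_0" by simp
qed

lift_definition minus_navier_space :: "navier_space \<Rightarrow> navier_space \<Rightarrow> navier_space" is "(-)"
proof -
  fix u v assume "u \<in> W22 \<inter> W12_0" "v \<in> W22 \<inter> W12_0"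
  then have "u + (-1) *\<^sub>R v \<in> W22 \<inter> W12_0"
    by (intro IntI W22_add W12_0_add W22_scaleR W12_0_scaleR) auto
  then show "u - v \<in> W22 \<inter> W12_0" by simp
qed

definition norm_navier_space :: "navier_space \<Rightarrow> real" where
  "norm_navier_space u = norm (second_deriv u)"

definition sgn_navier_space :: "navier_space \<Rightarrow> navier_space" where
  "sgn_navier_space u = inverse (norm u) *\<^sub>R u"

definition dist_navier_space :: "navier_space \<Rightarrow> navier_space \<Rightarrow> real" where
  "dist_navier_space u v = norm (u - v)"

definition uniformity_navier_space :: "(navier_space \<times> navier_space) filter" where
  "uniformity_navier_space = (INF e\<in>{0<..}. principal {(u, v). dist u v < e})"

definition open_navier_space :: "navier_space set \<Rightarrow> bool" where
  "open_navier_space S \<longleftrightarrow> (\<forall>u\<in>S. \<forall>\<^sub>F (u', v) in uniformity. u' = u \<longrightarrow> v \<in> S)"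

lemma to_L2_W12: "to_L2 u \<in> W12" "weak_deriv (to_L2 u) \<in> W12"
  using to_L2[of u] by (simp_all add: W22_def)

lemma second_deriv_add: "second_deriv (u + v) = second_deriv u + second_deriv v"
  unfolding second_deriv_def plus_navier_space.rep_eq
  by (simp only: weak_deriv_add to_L2_W12)

lemma second_deriv_scaleR: "second_deriv (c *\<^sub>R u) = c *\<^sub>R second_deriv u"
  unfolding second_deriv_def scaleR_navier_space.rep_eq
  by (simp only: weak_deriv_scaleR to_L2_W12)

lemma norm_navier_space_zero_iff:
  fixes u :: navier_space
  shows "norm u = 0 \<longleftrightarrow> u = 0"
proof
  assume "norm u = 0"
  then have "norm (second_deriv u) = 0" unfolding norm_navier_space_def .
  then have "to_L2 u = 0" by (rule to_L2_eq_0)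
  then have "to_L2 u = to_L2 0"
    by (simp only: zero_navier_space.rep_eq)
  then show "u = 0" by (simp only: to_L2_inject)
next
  assume "u = 0"
  then show "norm u = 0"
    unfolding norm_navier_space_def second_deriv_def
    by (simp only: zero_navier_space.rep_eq weak_deriv_zero norm_zero)
qed

instance
proof
  fix a b c :: navier_space and r s :: real and U :: "navier_space set"
  note eq = to_L2_inject[symmetric] plus_navier_space.rep_eq zero_navier_space.rep_eq
    uminus_navier_space.rep_eq minus_navier_space.rep_eq scaleR_navier_space.rep_eq
  show "a + b + c = a + (b + c)" by (simp only: eq add.assoc)
  show "a + b = b + a" by (simp only: eq add.commute)
  show "0 + a = a" by (simp only: eq add_0_left)
  show "- a + a = 0" by (simp only: eq left_minus)
  show "a - b = a + - b" by (simp only: eq diff_conv_add_uminus)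
  show "r *\<^sub>R (a + b) = r *\<^sub>R a + r *\<^sub>R b" by (simp only: eq scaleR_add_right)
  show "(r + s) *\<^sub>R a = r *\<^sub>R a + s *\<^sub>R a" by (simp only: eq scaleR_add_left)
  show "r *\<^sub>R s *\<^sub>R a = (r * s) *\<^sub>R a" by (simp only: eq scaleR_scaleR)
  show "1 *\<^sub>R a = a" by (simp only: eq scaleR_one)
  show "dist a b = norm (a - b)" by (rule dist_navier_space_def)
  show "sgn a = inverse (norm a) *\<^sub>R a" by (rule sgn_navier_space_def)
  show "uniformity = (INF e\<in>{0<..}. principal {(x, y). dist (x::navier_space) y < e})"
    by (rule uniformity_navier_space_def)
  show "open U \<longleftrightarrow> (\<forall>x\<in>U. \<forall>\<^sub>F (x', y) in uniformity. x' = x \<longrightarrow> y \<in> U)"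
    by (rule open_navier_space_def)
  show "norm a = 0 \<longleftrightarrow> a = 0" by (rule norm_navier_space_zero_iff)
  show "norm (a + b) \<le> norm a + norm b"
    unfolding norm_navier_space_def second_deriv_add by (rule norm_triangle_ineq)
  show "norm (r *\<^sub>R a) = \<bar>r\<bar> * norm a"
    unfolding norm_navier_space_def second_deriv_scaleR by (rule norm_scaleR)
qed

end

lemma second_deriv_diff: "second_deriv (u - v) = second_deriv u - second_deriv v"
  using second_deriv_add[of "u - v" v] by simp

lemma dist_navier_space_eq: "dist u v = dist (second_deriv u) (second_deriv v)"
proof -
  have "dist u v = norm (u - v)" by (rule dist_norm)
  also have "\<dots> = norm (second_deriv (u - v))" by (rule norm_navier_space_def)
  also have "\<dots> = norm (second_deriv u - second_deriv v)" by (simp only: second_deriv_diff)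
  also have "\<dots> = dist (second_deriv u) (second_deriv v)" by (rule dist_norm[symmetric])
  finally show ?thesis .
qed

instance navier_space :: second_countable_topology
proof
  obtain D :: "L2 set set" where D: "countable D" "\<And>C. C \<in> D \<Longrightarrow> open C"
      "\<And>S. open S \<Longrightarrow> \<exists>U. U \<subseteq> D \<and> S = \<Union>U"
    by (rule univ_second_countable) (rule that)
  define E where "E = (\<lambda>b. SOME u. second_deriv u \<in> b) ` D"
  have E: "countable E" using D(1) by (simp add: E_def)
  show "\<exists>B::navier_space set set. countable B \<and> open = generate_topology B"
  proof (rule countable_subbasis_if_dense[OF E])
    fix u :: navier_space and e :: real assume "e > 0"
    then have "second_deriv u \<in> ball (second_deriv u) e" by simp
    moreover obtain U where U: "U \<subseteq> D \<and> ball (second_deriv u) e = \<Union>U"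
      using D(3)[OF open_ball] by (rule exE)
    ultimately obtain b where b: "b \<in> U" "second_deriv u \<in> b" by auto
    have "b \<in> D" "b \<subseteq> ball (second_deriv u) e" using U b(1) by auto
    have "second_deriv (SOME u. second_deriv u \<in> b) \<in> b" using b(2) by (rule someI)
    then have "second_deriv (SOME u. second_deriv u \<in> b) \<in> ball (second_deriv u) e"
      using \<open>b \<subseteq> _\<close> by (rule subsetD[rotated])
    then have "dist (SOME u. second_deriv u \<in> b) u < e"
      unfolding dist_navier_space_eq mem_ball by (simp only: dist_commute)
    moreover have "(SOME u. second_deriv u \<in> b) \<in> E"
      unfolding E_def using \<open>b \<in> D\<close> by (rule imageI)
    ultimately show "\<exists>d\<in>E. dist d u < e" by (rule bexI)
  qed
qed

section \<open>Elastic energy and FVI gradient flows\<close>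

definition energy :: "navier_space \<Rightarrow> real" where
  "energy u = (\<integral>x. (fun_of (second_deriv u) x)\<^sup>2
      / (1 + (fun_of (weak_deriv (to_L2 u)) x)\<^sup>2) powr (5 / 2) \<partial>unit_itv)"

definition G_fun :: "real \<Rightarrow> real" where
  "G_fun s = (LBINT t=0..s. (1 + t\<^sup>2) powr (- 5 / 4))"

definition obstacle :: "(real \<Rightarrow> real) \<Rightarrow> bool" where
  "obstacle \<psi> \<longleftrightarrow> continuous_on {0..1} \<psi> \<and> \<psi> 0 < 0 \<and> \<psi> 1 < 0 \<and> (\<exists>x0\<in>{0<..<1}. \<psi> x0 > 0)"

definition admissible :: "(real \<Rightarrow> real) \<Rightarrow> navier_space set" where
  "admissible \<psi> = {u. AE x in unit_itv. fun_of (to_L2 u) x \<ge> \<psi> x}"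

abbreviation time_itv :: "real measure" where
  "time_itv \<equiv> lebesgue_on {0<..}"

text \<open>
  Functions of time are total functions on \<open>real\<close> of which only the values on \<open>{0<..}\<close>, up to
  null sets, matter. As \<open>L2\<close> and \<open>navier_space\<close> are separable, measurability with respect to
  \<open>time_itv\<close> is strong (Bochner) measurability.
\<close>

definition Linf :: "(real \<Rightarrow> 'a::{real_normed_vector, second_countable_topology}) set" where
  "Linf = {u \<in> borel_measurable time_itv. \<exists>C. AE t in time_itv. norm (u t) \<le> C}"

text \<open>
  \<open>D12_deriv u w\<close>: the function \<open>u\<close> belongs to $D^{1,2}((0,\infty),V)$ and \<open>w\<close> is (a representative
  of) its weak time derivative.
\<close>

definition D12_deriv ::
    "(real \<Rightarrow> 'a::{banach, second_countable_topology}) \<Rightarrow> (real \<Rightarrow> 'a) \<Rightarrow> bool" where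
  "D12_deriv u w \<longleftrightarrow> has_weak_derivative_on u w {0<..} \<and>
     w \<in> borel_measurable time_itv \<and> integrable time_itv (\<lambda>t. (norm (w t))\<^sup>2)"

definition FVI_gradient_flow ::
    "(real \<Rightarrow> real) \<Rightarrow> navier_space \<Rightarrow> (real \<Rightarrow> navier_space) \<Rightarrow> bool" where
  "FVI_gradient_flow \<psi> u0 u \<longleftrightarrow>
     u \<in> Linf \<and>
     (\<exists>w. D12_deriv (\<lambda>t. to_L2 (u t)) w \<and>
        (AE t in time_itv. u t \<in> admissible \<psi>) \<and>
        (\<exists>\<phi>. antimono_on {0..} \<phi> \<and> \<phi> 0 = energy u0 \<and> (AE t in time_itv. energy (u t) = \<phi> t)) \<and>
        (\<exists>c. continuous_on {0..} c \<and> (AE t in time_itv. c t = to_L2 (u t)) \<and> c 0 = to_L2 u0) \<and>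
        (AE t in time_itv. \<forall>v\<in>admissible \<psi>.
           inner (w t) (to_L2 v - to_L2 (u t)) + frechet_derivative energy (at (u t)) (v - u t) \<ge> 0))"

text \<open>
  \<open>C1_representative u U\<close>: the map \<open>U\<close> is the representative of \<open>u\<close> in
  $C([0,\infty),C^1([0,1]))$, with \<open>U t x\<close> for $u(t)(x)$. Continuity in the $C^1$ norm is uniform
  convergence of \<open>U t\<close> and of its derivative \<open>U' t\<close>. Only \<open>t \<ge> 0\<close> and \<open>x \<in> {0..1}\<close> matter.
\<close>

definition C1_representative :: "(real \<Rightarrow> navier_space) \<Rightarrow> (real \<Rightarrow> real \<Rightarrow> real) \<Rightarrow> bool" where
  "C1_representative u U \<longleftrightarrow>
     (\<exists>U'. (\<forall>t\<ge>0. continuous_on {0..1} (U' t) \<and>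
              (\<forall>x\<in>{0..1}. (U t has_field_derivative U' t x) (at x within {0..1}))) \<and>
           (\<forall>t0\<ge>0. uniform_limit {0..1} U (U t0) (at t0 within {0..}) \<and>
                    uniform_limit {0..1} U' (U' t0) (at t0 within {0..}))) \<and>
     (AE t in time_itv. AE x in unit_itv. U t x = fun_of (to_L2 (u t)) x)"

end

theory Submission
  imports Defs
begin

text \<open>
  Suppose the flow stays off the obstacle after some time $T$. Then $(1-\epsilon)u(t)$ is an admissible
  competitor, so $(\dot u, u) + D\mathcal{E}(u)(u) \le 0$ for almost every $t > T$. As
  $u(t)$ vanishes at both endpoints, $u'(t)$ has a zero, and the chain rule for $G \circ u'$ together
  with the Cauchy--Schwarz inequality gives
  $|G(u')| \le \mathcal{E}(u)^{1/2} \le \mathcal{E}(u_0)^{1/2} < G(\sqrt{2/3})$. Hence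
  $u'^2$ stays below a constant smaller than $2/3$, which makes
  $D\mathcal{E}(u)(u) = \int \frac{u''^2}{(1+u'^2)^{5/2}} \cdot \frac{2-3u'^2}{1+u'^2}$ bounded below by a multiple
  of $\|u''\|^2$. The latter is bounded below because $u$ has to pass over a positive value of the
  obstacle, and $\|u\|$ is bounded. So $\|\dot u(t)\|$ is bounded below for large $t$,
  contradicting $\dot u \in L^2$.
\<close>

section \<open>Primitives of square integrable functions\<close>

text \<open>Elements of \<open>L2\<close> are classes, so u' needs a continuous representative
  before its zeros and pointwise bounds make sense. It comes from a primitive defined as an inner
  product. That primitive is linear and continuous in the function being integrated, so integration
  by parts and the chain rule can be proved for continuous functions by classical calculus and
  carried to all of \<open>L2\<close> by density of polynomials. The final argument needs no
  evolution equation: the flow is described for almost every t only, and the contradiction is that a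
  function bounded below by a positive constant on a half line is not integrable. The number 2/3 is
  where 2 - 3p^2 changes sign, and the strict energy inequality keeps u'^2 away from it uniformly in
  time. \<open>FVI_gradient_flow\<close> refers to \<open>frechet_derivative\<close>, so the energy
  has to be shown differentiable, and its derivative identified, before the variational inequality
  can be evaluated.\<close>

lemma integral_unit_itv_eq:
  assumes "integrable unit_itv f"
  shows "(\<integral>x. f x \<partial>unit_itv) = integral {0..1} (f :: real \<Rightarrow> real)"
  using lebesgue_integral_eq_integral[OF assms]
  by (simp add: integral_open_interval_real)

lemma square_integrable_continuous:
  assumes "continuous_on {0..1} f" shows "square_integrable f"
proof -
  have "bounded (f ` {0..1})"
    by (intro compact_imp_bounded compact_continuous_image assms) auto
  then obtain B where "\<And>x. x \<in> {0..1} \<Longrightarrow> \<bar>f x\<bar> \<le> B"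
    unfolding bounded_iff by (metis imageI real_norm_def)
  moreover have "f \<in> borel_measurable unit_itv"
    by (rule continuous_imp_measurable_on_sets_lebesgue)
       (auto intro: continuous_on_subset[OF assms])
  ultimately show ?thesis by (intro square_integrable_bounded[where B = B]) auto
qed

lemma norm_abs_L2_mono:
  assumes "square_integrable f" "square_integrable g"
    and "AE x in unit_itv. \<bar>f x\<bar> \<le> \<bar>g x\<bar>"
  shows "norm (abs_L2 f) \<le> norm (abs_L2 g)"
  unfolding norm_abs_L2[OF assms(1)] norm_abs_L2[OF assms(2)]
  by (intro real_sqrt_le_mono integral_mono_AE)
     (use assms in \<open>auto simp: square_integrable_def abs_le_square_iff\<close>)

lemma norm_abs_L2_bound:
  assumes "square_integrable f" "\<And>x. 0 < x \<Longrightarrow> x < 1 \<Longrightarrow> \<bar>f x\<bar> \<le> B"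
  shows "norm (abs_L2 f) \<le> B"
proof -
  have B: "0 \<le> B" using assms(2)[of "1/2"] by simp
  have sq: "square_integrable (\<lambda>x. B)" by (rule square_integrable_continuous) simp
  have "norm (abs_L2 f) \<le> norm (abs_L2 (\<lambda>x. B))"
    using assms B by (intro norm_abs_L2_mono sq) auto
  also have "\<dots> = B" using B by (simp add: norm_abs_L2[OF sq] measure_restrict_space)
  finally show ?thesis .
qed

lemma square_integrable_times_bounded:
  assumes f: "square_integrable f" and m: "m \<in> borel_measurable unit_itv"
    and bd: "\<And>x. 0 < x \<Longrightarrow> x < 1 \<Longrightarrow> \<bar>m x\<bar> \<le> B"
  shows "square_integrable (\<lambda>x. m x * f x)"
    and "norm (abs_L2 (\<lambda>x. m x * f x)) \<le> B * norm (abs_L2 f)"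
proof -
  have B: "0 \<le> B" using bd[of "1/2"] by simp
  have le: "\<bar>m x * f x\<bar> \<le> \<bar>B * f x\<bar>" if "0 < x" "x < 1" for x
    using bd[OF that] B by (simp add: abs_mult mult_right_mono)
  have [measurable]: "f \<in> borel_measurable unit_itv" using f by measurable
  note m [measurable]
  have sqB: "square_integrable (\<lambda>x. B * f x)" by (rule square_integrable_scale[OF f])
  show sq: "square_integrable (\<lambda>x. m x * f x)"
    unfolding square_integrable_def
  proof
    show "integrable unit_itv (\<lambda>x. (m x * f x)\<^sup>2)"
    proof (rule Bochner_Integration.integrable_bound)
      show "integrable unit_itv (\<lambda>x. (B * f x)\<^sup>2)" using sqB by (simp add: square_integrable_def)
      show "AE x in unit_itv. norm ((m x * f x)\<^sup>2) \<le> norm ((B * f x)\<^sup>2)"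
        using le by (intro AE_I2) (simp add: abs_le_square_iff)
    qed measurable
  qed measurable
  have "norm (abs_L2 (\<lambda>x. m x * f x)) \<le> norm (abs_L2 (\<lambda>x. B * f x))"
    using le by (intro norm_abs_L2_mono sq sqB) auto
  also have "abs_L2 (\<lambda>x. B * f x) = B *\<^sub>R abs_L2 f" using f by (simp add: scaleR_L2.abs_eq)
  finally show "norm (abs_L2 (\<lambda>x. m x * f x)) \<le> B * norm (abs_L2 f)" using B by simp
qed

text \<open>For x in [0,1] this is the integral of \<open>v\<close> from 0 to x. As a pairing with
  an indicator it depends only on the class of \<open>v\<close>, and linearity and continuity in
  \<open>v\<close> come from the inner product.\<close>

definition prim :: "L2 \<Rightarrow> real \<Rightarrow> real" where
  "prim v x = inner v (abs_L2 (indicator {..x}))"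

lemma prim_add: "prim (v + w) x = prim v x + prim w x"
  by (simp add: prim_def inner_add_left)

lemma prim_diff: "prim (v - w) x = prim v x - prim w x"
  by (simp add: prim_def inner_diff_left)

lemma prim_scaleR: "prim (c *\<^sub>R v) x = c * prim v x"
  by (simp add: prim_def)

lemma square_integrable_indicator: "square_integrable (indicator {..x} :: real \<Rightarrow> real)"
proof (rule square_integrable_bounded)
  show "indicator {..x} \<in> borel_measurable unit_itv"
    by (intro measurable_restrict_space1 borel_measurable_indicator) auto
  show "\<bar>indicator {..x} y\<bar> \<le> (1::real)" for y :: real by (simp add: indicator_def)
qed

text \<open>Cauchy-Schwarz against the indicator of the interval between the two points, whose norm
  is at most the square root of the length. The sup bounds for primitives and slopes, and later the
  bound for G, rest on this Hoelder estimate.\<close>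

lemma abs_prim_diff_le: "\<bar>prim v x - prim v y\<bar> \<le> norm v * sqrt \<bar>x - y\<bar>"
proof -
  have *: "\<bar>prim v x - prim v y\<bar> \<le> norm v * sqrt (x - y)" if "y \<le> x" for x y
  proof -
    let ?d = "\<lambda>t. indicator {..x} t - indicator {..y} t :: real"
    have sq: "square_integrable ?d"
      by (intro square_integrable_diff square_integrable_indicator)
    have "(\<integral>t. (?d t)\<^sup>2 \<partial>unit_itv) = (\<integral>t. indicator ({y<..x} \<inter> {0<..<1}) t \<partial>unit_itv)"
      using that by (intro Bochner_Integration.integral_cong) (auto simp: indicator_def)
    also have "\<dots> = measure lebesgue ({y<..x} \<inter> {0<..<1})"
      by (subst Bochner_Integration.integral_indicator)
         (auto simp: sets_restrict_space measure_restrict_space emeasure_restrict_space Int_absorb2 space_restrict_space intro!: emeasure_lborel_cbox_finite)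
    also have "\<dots> \<le> measure lebesgue {y..x}"
      by (intro measure_mono_fmeasurable) auto
    also have "\<dots> = x - y" using that by simp
    finally have "norm (abs_L2 ?d) \<le> sqrt (x - y)"
      by (simp add: norm_abs_L2[OF sq])
    moreover have "prim v x - prim v y = inner v (abs_L2 ?d)"
      by (simp add: prim_def inner_diff_right[symmetric] diff_abs_L2 square_integrable_indicator)
    ultimately show ?thesis
      using Cauchy_Schwarz_ineq2[of v "abs_L2 ?d"] mult_left_mono[of "norm (abs_L2 ?d)" "sqrt (x - y)" "norm v"]
      by simp
  qed
  show ?thesis using *[of x y] *[of y x] by (cases "x \<le> y") (auto simp: abs_minus_commute)
qed

lemma prim_0 [simp]: "prim v 0 = 0"
proof -
  have "inner v (abs_L2 (indicator {..0})) = inner v 0"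
  proof (rule arg_cong[where f = "inner v"])
    show "abs_L2 (indicator {..0}) = 0"
    proof (rule L2_eqI)
      have "AE x in unit_itv. fun_of 0 x = 0"
        unfolding zero_L2_def by (rule fun_of_abs) simp
      then show "AE x in unit_itv. fun_of (abs_L2 (indicator {..0})) x = fun_of 0 x"
        using fun_of_abs[OF square_integrable_indicator[of 0]] AE_space
        by eventually_elim auto
    qed
  qed
  then show ?thesis by (simp add: prim_def)
qed

lemma abs_prim_le:
  assumes "x \<in> {0..1}" shows "\<bar>prim v x\<bar> \<le> norm v"
proof -
  have "sqrt \<bar>x\<bar> \<le> 1" using assms by simp
  then have "norm v * sqrt \<bar>x\<bar> \<le> norm v" by (simp add: mult_left_le)
  then show ?thesis using abs_prim_diff_le[of v x 0] by simp
qed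

lemma continuous_on_prim: "continuous_on S (prim v)"
proof (rule continuous_at_imp_continuous_on, rule ballI)
  fix x
  have "((\<lambda>y. norm v * sqrt \<bar>y - x\<bar>) \<longlongrightarrow> norm v * sqrt \<bar>x - x\<bar>) (at x)"
    by (intro tendsto_intros)
  then have "((\<lambda>y. norm v * sqrt \<bar>y - x\<bar>) \<longlongrightarrow> 0) (at x)" by simp
  then have "((\<lambda>y. prim v y - prim v x) \<longlongrightarrow> 0) (at x)"
    by (rule Lim_null_comparison[rotated]) (use abs_prim_diff_le in auto)
  then show "isCont (prim v) x" by (simp add: isCont_def LIM_zero_iff)
qed

lemma square_integrable_prim: "square_integrable (prim v)"
  by (rule square_integrable_continuous[OF continuous_on_prim])

lemma norm_abs_L2_prim_le: "norm (abs_L2 (prim v)) \<le> norm v"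
  by (rule norm_abs_L2_bound[OF square_integrable_prim abs_prim_le]) auto

lemma prim_eq_integral:
  assumes f: "continuous_on {0..1} f" and x: "x \<in> {0..1}"
  shows "prim (abs_L2 f) x = integral {0..x} f"
proof -
  have sq: "square_integrable f" by (rule square_integrable_continuous[OF f])
  have "prim (abs_L2 f) x = (\<integral>t. f t * indicator {..x} t \<partial>unit_itv)"
    unfolding prim_def by (rule inner_abs_L2[OF sq square_integrable_indicator])
  also have "\<dots> = integral {0..1} (\<lambda>t. f t * indicator {..x} t)"
    by (rule integral_unit_itv_eq[OF square_integrable_mult[OF sq square_integrable_indicator]])
  also have "(\<lambda>t. f t * indicator {..x} t) = (\<lambda>t. if t \<in> {..x} then f t else 0)"
    by (auto simp: fun_eq_iff)
  also have "integral {0..1} \<dots> = integral ({..x} \<inter> {0..1}) f"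
    by (rule integral_restrict_Int)
  also have "{..x} \<inter> {0..1} = {0..x}" using x by auto
  finally show ?thesis .
qed

lemma prim_has_derivative:
  assumes f: "continuous_on {0..1} f" and x: "x \<in> {0..1}"
  shows "(prim (abs_L2 f) has_real_derivative f x) (at x within {0..1})"
proof -
  have "((\<lambda>x. integral {0..x} f) has_real_derivative f x) (at x within {0..1})"
    by (rule integral_has_real_derivative[OF f x])
  then show ?thesis
    by (rule has_field_derivative_transform_within[where d = 1])
       (use x in \<open>auto simp: prim_eq_integral[OF f]\<close>)
qed

lemma prim_deriv:
  assumes "smooth f" and x: "x \<in> {0..1}"
  shows "prim (abs_L2 (deriv f)) x = f x - f 0"
proof -
  have "prim (abs_L2 (deriv f)) x = integral {0..x} (deriv f)"
    by (rule prim_eq_integral[OF smooth_continuous[OF smooth_deriv[OF assms(1)]] x])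
  also have "\<dots> = f x - f 0"
    using x smooth_DERIV[OF assms(1)]
    by (intro integral_unique fundamental_theorem_of_calculus)
       (auto simp: has_real_derivative_iff_has_vector_derivative[symmetric] intro: has_field_derivative_at_within)
  finally show ?thesis .
qed

lemma integral_unit_itv_derivative:
  assumes "continuous_on {0..1} f"
    and "\<And>x. x \<in> {0..1} \<Longrightarrow> (F has_real_derivative f x) (at x within {0..1})"
  shows "(\<integral>x. f x \<partial>unit_itv) = F 1 - F 0"
proof -
  have "(\<integral>x. f x \<partial>unit_itv) = integral {0..1} f"
    by (intro integral_unit_itv_eq square_integrable_integrable square_integrable_continuous assms)
  also have "\<dots> = F 1 - F 0"
    using assms(2)
    by (intro integral_unique fundamental_theorem_of_calculus)
       (auto simp: has_real_derivative_iff_has_vector_derivative[symmetric])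
  finally show ?thesis .
qed

abbreviation one_L2 :: L2 where "one_L2 \<equiv> abs_L2 (\<lambda>x. 1)"

lemma square_integrable_const: "square_integrable (\<lambda>x. c)"
  by (rule square_integrable_continuous) simp

lemma abs_L2_cong:
  assumes "square_integrable f" "square_integrable g" "AE x in unit_itv. f x = g x"
  shows "abs_L2 f = abs_L2 g"
  using assms by (intro Quotient3_rel_abs[OF Quotient3_L2] conjI)

lemma one_L2_neq_0: "one_L2 \<noteq> 0"
proof -
  have "norm one_L2 = 1" by (simp add: norm_abs_L2[OF square_integrable_const] measure_restrict_space)
  then show ?thesis by auto
qed

lemma inner_one_L2: "square_integrable f \<Longrightarrow> inner one_L2 (abs_L2 f) = (\<integral>x. f x \<partial>unit_itv)"
  by (simp add: inner_abs_L2 square_integrable_const)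

lemma prim_1: "prim v 1 = inner v one_L2"
proof -
  have "abs_L2 (indicator {..1}) = one_L2"
    using AE_space
    by (intro abs_L2_cong square_integrable_indicator square_integrable_const)
       (auto elim: eventually_mono)
  then show ?thesis by (simp add: prim_def)
qed

lemma abs_L2_prim_diff: "abs_L2 (prim v) - abs_L2 (prim w) = abs_L2 (prim (v - w))"
  by (simp add: diff_abs_L2 square_integrable_prim prim_diff[abs_def])

lemma tendsto_abs_L2_prim:
  assumes "(v \<longlongrightarrow> w) F"
  shows "((\<lambda>n. abs_L2 (prim (v n))) \<longlongrightarrow> abs_L2 (prim w)) F"
proof -
  have "((\<lambda>n. norm (v n - w)) \<longlongrightarrow> 0) F"
    using assms by (simp add: tendsto_norm_zero LIM_zero)
  then have "((\<lambda>n. abs_L2 (prim (v n)) - abs_L2 (prim w)) \<longlongrightarrow> 0) F"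
    by (rule Lim_null_comparison[rotated])
       (simp add: abs_L2_prim_diff norm_abs_L2_prim_le)
  then show ?thesis by (simp add: LIM_zero_iff)
qed

section \<open>Weak derivatives and primitives\<close>

lemma continuous_on_rat_bernstein: "continuous_on S (rat_bernstein q)"
  unfolding rat_bernstein_def Bernstein_def by (intro continuous_intros)

lemma rat_bernstein_approx:
  obtains s where "(\<lambda>n. abs_L2 (rat_bernstein (s n))) \<longlonglongrightarrow> v"
proof -
  have "v \<in> closure (range (\<lambda>q. abs_L2 (rat_bernstein q)))"
    unfolding closure_approachable using L2_dense by blast
  then obtain x where x: "\<And>n. x n \<in> range (\<lambda>q. abs_L2 (rat_bernstein q))" "x \<longlonglongrightarrow> v"
    unfolding closure_sequential by blast
  then have "\<forall>n. \<exists>q. x n = abs_L2 (rat_bernstein q)" by auto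
  then obtain s where "\<And>n. x n = abs_L2 (rat_bernstein (s n))" by metis
  then have "x = (\<lambda>n. abs_L2 (rat_bernstein (s n)))" by auto
  with x(2) that show thesis by simp
qed

lemma test_functions_endpoints:
  assumes "\<phi> \<in> test_functions {0<..<1}" shows "\<phi> 0 = 0" "\<phi> 1 = 0"
  using assms by (force simp: test_functions_def)+

text \<open>For continuous \<open>v\<close> this is integration by parts, without boundary terms
  because test functions vanish at 0 and 1. For a fixed test function both sides are continuous in
  \<open>v\<close>, so polynomial approximation gives the general case.\<close>

lemma has_weak_deriv_prim: "has_weak_deriv (abs_L2 (prim v)) v"
  unfolding has_weak_deriv_iff
proof
  fix \<phi> assume \<phi>: "\<phi> \<in> test_functions {0<..<1}"
  have sm: "smooth \<phi>" by (rule test_function_smooth[OF \<phi>])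
  have sq: "square_integrable \<phi>" "square_integrable (deriv \<phi>)"
    by (auto intro: smooth_square_integrable smooth_deriv sm)
  have poly: "inner (abs_L2 (prim (abs_L2 f))) (abs_L2 (deriv \<phi>)) = - inner (abs_L2 f) (abs_L2 \<phi>)"
    if f: "continuous_on {0..1} f" for f
  proof -
    let ?F = "prim (abs_L2 f)"
    have sqf: "square_integrable f" by (rule square_integrable_continuous[OF f])
    have "(\<integral>x. ?F x * deriv \<phi> x + f x * \<phi> x \<partial>unit_itv) = ?F 1 * \<phi> 1 - ?F 0 * \<phi> 0"
    proof (rule integral_unit_itv_derivative)
      show "continuous_on {0..1} (\<lambda>x. ?F x * deriv \<phi> x + f x * \<phi> x)"
        by (intro continuous_intros continuous_on_prim f smooth_continuous smooth_deriv sm)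
      fix x :: real assume x: "x \<in> {0..1}"
      show "((\<lambda>x. ?F x * \<phi> x) has_real_derivative ?F x * deriv \<phi> x + f x * \<phi> x) (at x within {0..1})"
        using DERIV_mult[OF prim_has_derivative[OF f x] has_field_derivative_at_within[OF smooth_DERIV[OF sm]]]
        by (simp add: algebra_simps)
    qed
    then show ?thesis
      using sq sqf square_integrable_prim[of "abs_L2 f"]
      by (simp add: inner_abs_L2 square_integrable_mult test_functions_endpoints[OF \<phi>])
  qed
  obtain s where s: "(\<lambda>n. abs_L2 (rat_bernstein (s n))) \<longlonglongrightarrow> v"
    by (rule rat_bernstein_approx)
  show "inner (abs_L2 (prim v)) (abs_L2 (deriv \<phi>)) = - inner v (abs_L2 \<phi>)"
  proof (rule LIMSEQ_unique)
    show "(\<lambda>n. inner (abs_L2 (prim (abs_L2 (rat_bernstein (s n))))) (abs_L2 (deriv \<phi>)))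
        \<longlonglongrightarrow> inner (abs_L2 (prim v)) (abs_L2 (deriv \<phi>))"
      by (intro tendsto_intros tendsto_abs_L2_prim s)
    show "(\<lambda>n. inner (abs_L2 (prim (abs_L2 (rat_bernstein (s n))))) (abs_L2 (deriv \<phi>)))
        \<longlonglongrightarrow> - inner v (abs_L2 \<phi>)"
      unfolding poly[OF continuous_on_rat_bernstein] by (intro tendsto_intros s)
  qed
qed

text \<open>Mean zero makes the primitive that starts at 0 return to 0 at the right endpoint. It is
  constant to the left and to the right of the support of \<open>\<eta>\<close>, hence zero there,
  and so compactly supported.\<close>

lemma test_function_antiderivative:
  assumes \<eta>: "\<eta> \<in> test_functions {0<..<1}" and 0: "inner one_L2 (abs_L2 \<eta>) = 0"
  obtains \<phi> where "\<phi> \<in> test_functions {0<..<1}" "deriv \<phi> = \<eta>"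
proof -
  have sm: "smooth \<eta>" by (rule test_function_smooth[OF \<eta>])
  obtain K where K: "compact K" "K \<subseteq> {0<..<1}" "\<And>x. x \<notin> K \<Longrightarrow> \<eta> x = 0"
    using \<eta> by (auto simp: test_functions_def)
  \<comment> \<open>Adding 1/2 makes the set nonempty, so that it has a minimum and a maximum, and
    leaves it inside (0,1).\<close>
  have cK: "compact (insert (1/2) K)" using K(1) by (rule compact_insert)
  obtain a where a: "a \<in> insert (1/2) K" "\<And>x. x \<in> insert (1/2) K \<Longrightarrow> a \<le> x"
    using compact_attains_inf[OF cK] by blast
  obtain b where b: "b \<in> insert (1/2) K" "\<And>x. x \<in> insert (1/2) K \<Longrightarrow> x \<le> b"
    using compact_attains_sup[OF cK] by blast
  have ab: "0 < a" "b < 1" using a(1) b(1) K(2) by auto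
  have zero: "\<eta> x = 0" if "x < a \<or> b < x" for x
    using a(2)[of x] b(2)[of x] K(3)[of x] that by force
  have "isCont \<eta> x" for x using smooth_DERIV[OF sm] by (rule DERIV_isCont)
  then obtain F where "\<And>x. (F has_vector_derivative \<eta> x) (at x)"
    using einterval_antiderivative[of "-\<infinity>" "\<infinity>" \<eta>] by auto
  then have F: "(F has_real_derivative \<eta> x) (at x)" for x
    by (simp add: has_real_derivative_iff_has_vector_derivative)
  define \<phi> where "\<phi> x = F x - F 0" for x
  have d: "(\<phi> has_real_derivative \<eta> x) (at x)" for x
    unfolding \<phi>_def using F by (auto intro!: derivative_eq_intros)
  then have deriv: "deriv \<phi> = \<eta>" by (auto intro: DERIV_imp_deriv)
  \<comment> \<open>Only the derivative of \<open>\<phi>\<close> is known to be smooth so far; the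
    smooth functions together with \<open>\<phi>\<close> are closed under differentiation, which is
    what coinduction asks for.\<close>
  have sm\<phi>: "smooth \<phi>"
  proof (rule smooth_coinduct[of "\<lambda>f. f = \<phi> \<or> smooth f"])
    fix g assume "g = \<phi> \<or> smooth g"
    then show "\<exists>g'. (\<forall>x. (g has_real_derivative g' x) (at x)) \<and> (g' = \<phi> \<or> smooth g')"
      using d sm smooth_DERIV smooth_deriv by blast
  qed simp
  have "(\<integral>x. \<eta> x \<partial>unit_itv) = \<phi> 1 - \<phi> 0"
    by (rule integral_unit_itv_derivative) (auto intro: smooth_continuous sm has_field_derivative_at_within d)
  then have \<phi>01: "\<phi> 0 = 0" "\<phi> 1 = 0"
    using 0 inner_one_L2[OF smooth_square_integrable[OF sm]] by (auto simp: \<phi>_def)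
  have const: "\<phi> x = \<phi> y"
    if S: "convex S" "\<And>x. x \<in> S \<Longrightarrow> \<eta> x = 0" and xy: "x \<in> S" "y \<in> S" for S x y
    using has_field_derivative_zero_constant[OF S(1), of \<phi>] has_field_derivative_at_within[OF d] S(2) xy
    by metis
  have "\<phi> x = 0" if "x \<notin> {a..b}" for x
    using that const[of "{..<a}" x 0] const[of "{b<..}" x 1] ab \<phi>01 zero by force
  then have "\<phi> \<in> test_functions {0<..<1}"
    unfolding test_functions_def using sm\<phi> ab
    by (intro CollectI conjI exI[of _ "{a..b}"]) auto
  with deriv show thesis by (rule that[rotated])
qed

text \<open>
  Du Bois-Reymond: every test function differs from a multiple of a fixed one by a test function of
  mean zero, that is, by the derivative of a test function.
\<close>

lemma weak_deriv_0_imp_const: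
  assumes "has_weak_deriv z 0" obtains c where "z = c *\<^sub>R one_L2"
proof -
  have z: "inner z (abs_L2 (deriv \<phi>)) = 0" if "\<phi> \<in> test_functions {0<..<1}" for \<phi>
    using assms that by (simp add: has_weak_deriv_iff)
  obtain \<theta> where \<theta>: "\<theta> \<in> test_functions {0<..<1}" "inner one_L2 (abs_L2 \<theta>) \<noteq> 0"
    using test_functions_dense[of one_L2] one_L2_neq_0 by blast
  \<comment> \<open>The only candidate for the multiple, found by pairing the desired equation with
    \<open>\<theta>\<close>.\<close>
  define c where "c = inner z (abs_L2 \<theta>) / inner one_L2 (abs_L2 \<theta>)"
  have "z - c *\<^sub>R one_L2 = 0"
  proof (rule test_functions_dense)
    fix \<eta> assume \<eta>: "\<eta> \<in> test_functions {0<..<1}"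
    define a where "a = inner one_L2 (abs_L2 \<eta>) / inner one_L2 (abs_L2 \<theta>)"
    have test: "(\<lambda>x. \<eta> x + (- a) * \<theta> x) \<in> test_functions {0<..<1}"
      by (intro test_functions_add test_functions_scale \<eta> \<theta>)
    have eq: "abs_L2 (\<lambda>x. \<eta> x + (- a) * \<theta> x) = abs_L2 \<eta> - a *\<^sub>R abs_L2 \<theta>"
      using test_functions_square_integrable[OF \<eta>] test_functions_square_integrable[OF \<theta>(1)]
      by (simp add: diff_abs_L2 scaleR_L2.abs_eq square_integrable_scale)
    have "inner one_L2 (abs_L2 (\<lambda>x. \<eta> x + (- a) * \<theta> x)) = 0"
      unfolding eq using \<theta>(2) by (simp add: inner_diff_right a_def)
    then obtain \<phi> where "\<phi> \<in> test_functions {0<..<1}" "deriv \<phi> = (\<lambda>x. \<eta> x + (- a) * \<theta> x)"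
      using test_function_antiderivative[OF test] by blast
    then have "inner z (abs_L2 \<eta> - a *\<^sub>R abs_L2 \<theta>) = 0" using z eq by metis
    then show "inner (z - c *\<^sub>R one_L2) (abs_L2 \<eta>) = 0"
      using \<theta>(2) by (simp add: inner_diff_left inner_diff_right a_def c_def field_simps)
  qed
  then show thesis by (intro that[of c]) simp
qed

lemma has_weak_deriv_imp_prim:
  assumes "has_weak_deriv p q" obtains c where "p = c *\<^sub>R one_L2 + abs_L2 (prim q)"
proof -
  have "has_weak_deriv (p - abs_L2 (prim q)) 0"
    using has_weak_deriv_add[OF assms has_weak_deriv_scaleR[OF has_weak_deriv_prim[of q], of "-1"]] by simp
  then obtain c where "p - abs_L2 (prim q) = c *\<^sub>R one_L2" by (rule weak_deriv_0_imp_const)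
  then show thesis by (intro that[of c]) (simp add: algebra_simps)
qed

text \<open>The approximating test functions vanish at both ends, so they are the primitives of
  their derivatives. Both facts survive the limit because primitives depend continuously on the
  integrand. This turns the closure definition of \<open>W12_0\<close> into boundary values.\<close>

lemma W12_0_prim:
  assumes "u \<in> W12_0"
  shows "u = abs_L2 (prim (weak_deriv u))" "prim (weak_deriv u) 1 = 0"
proof -
  obtain \<phi> where \<phi>: "\<And>n. \<phi> n \<in> test_functions {0<..<1}" "(\<lambda>n. abs_L2 (\<phi> n)) \<longlonglongrightarrow> u"
      "(\<lambda>n. abs_L2 (deriv (\<phi> n))) \<longlonglongrightarrow> weak_deriv u"
    using assms unfolding W12_0_def by blast
  have eq: "prim (abs_L2 (deriv (\<phi> n))) x = \<phi> n x" if "x \<in> {0..1}" for n x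
    using prim_deriv[OF test_function_smooth[OF \<phi>(1)] that] test_functions_endpoints[OF \<phi>(1)] by simp
  have "abs_L2 (prim (abs_L2 (deriv (\<phi> n)))) = abs_L2 (\<phi> n)" for n
    using eq by (intro abs_L2_cong square_integrable_prim test_functions_square_integrable[OF \<phi>(1)] AE_I2) auto
  then have "(\<lambda>n. abs_L2 (\<phi> n)) \<longlonglongrightarrow> abs_L2 (prim (weak_deriv u))"
    using tendsto_abs_L2_prim[OF \<phi>(3)] by simp
  with \<phi>(2) show "u = abs_L2 (prim (weak_deriv u))" by (rule LIMSEQ_unique)
  have "(\<lambda>n. prim (abs_L2 (deriv (\<phi> n))) 1) \<longlonglongrightarrow> prim (weak_deriv u) 1"
    unfolding prim_def by (intro tendsto_intros \<phi>)
  then show "prim (weak_deriv u) 1 = 0"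
    using test_functions_endpoints[OF \<phi>(1)] by (simp add: eq LIMSEQ_const_iff)
qed

section \<open>The continuous representative of the derivative\<close>

text \<open>The candidate for the continuous representative of u': a primitive of u'' whose free
  constant is fixed by the requirement of mean zero, which expresses u(0) = u(1).\<close>

definition slope :: "navier_space \<Rightarrow> real \<Rightarrow> real" where
  "slope u x = prim (second_deriv u) x - inner one_L2 (abs_L2 (prim (second_deriv u)))"

lemma continuous_on_slope: "continuous_on S (slope u)"
  unfolding slope_def by (intro continuous_intros continuous_on_prim)

lemma square_integrable_slope: "square_integrable (slope u)"
  by (rule square_integrable_continuous[OF continuous_on_slope])

lemma slope_add: "slope (u + v) x = slope u x + slope v x"
proof -
  have "abs_L2 (prim (second_deriv u + second_deriv v))
      = abs_L2 (prim (second_deriv u)) + abs_L2 (prim (second_deriv v))"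
    by (simp add: plus_L2.abs_eq square_integrable_prim prim_add[abs_def])
  then show ?thesis by (simp add: slope_def second_deriv_add prim_add inner_add_right)
qed

lemma slope_scaleR: "slope (c *\<^sub>R u) x = c * slope u x"
proof -
  have "abs_L2 (prim (c *\<^sub>R second_deriv u)) = c *\<^sub>R abs_L2 (prim (second_deriv u))"
    by (simp add: scaleR_L2.abs_eq square_integrable_prim prim_scaleR[abs_def])
  then show ?thesis by (simp add: slope_def second_deriv_scaleR prim_scaleR algebra_simps)
qed

lemma weak_deriv_to_L2: "weak_deriv (to_L2 u) = abs_L2 (slope u)"
proof -
  let ?p = "weak_deriv (to_L2 u)" and ?q = "second_deriv u"
  obtain c where c: "?p = c *\<^sub>R one_L2 + abs_L2 (prim ?q)"
    using has_weak_deriv_imp_prim[OF W12_has_weak_deriv[OF to_L2_W12(2)[of u]]]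
    unfolding second_deriv_def by blast
  have "to_L2 u \<in> W12_0" using to_L2[of u] by simp
  then have "inner one_L2 ?p = 0" using W12_0_prim(2) prim_1 inner_commute by metis
  moreover have "inner one_L2 one_L2 = 1"
    by (simp add: inner_one_L2 square_integrable_const measure_restrict_space)
  ultimately have "c = - inner one_L2 (abs_L2 (prim ?q))"
    unfolding c by (simp add: inner_add_right)
  moreover have "c *\<^sub>R one_L2 + abs_L2 (prim ?q) = abs_L2 (\<lambda>x. c * 1 + prim ?q x)"
    by (simp add: scaleR_L2.abs_eq plus_L2.abs_eq square_integrable_const square_integrable_prim)
  ultimately show ?thesis unfolding c by (simp add: slope_def[abs_def] add.commute)
qed

lemma fun_of_weak_deriv_to_L2: "AE x in unit_itv. fun_of (weak_deriv (to_L2 u)) x = slope u x"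
  unfolding weak_deriv_to_L2 by (rule fun_of_abs[OF square_integrable_slope])

lemma to_L2_eq_prim: "to_L2 u = abs_L2 (prim (abs_L2 (slope u)))"
  using W12_0_prim(1)[of "to_L2 u"] to_L2[of u] by (simp add: weak_deriv_to_L2)

text \<open>Rolle's theorem for the continuous representative of \<open>u\<close>, which vanishes at
  both ends and has \<open>slope u\<close> as classical derivative.\<close>

lemma slope_eq_0:
  obtains y where "y \<in> {0..1}" "slope u y = 0"
proof -
  let ?P = "prim (abs_L2 (slope u))"
  have "to_L2 u \<in> W12_0" using to_L2[of u] by simp
  then have "?P 0 = ?P 1" using W12_0_prim(2)[of "to_L2 u"] by (simp add: weak_deriv_to_L2)
  have d: "(?P has_real_derivative slope u x) (at x)" if "0 < x" "x < 1" for x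
  proof -
    have "at x within {0..1} = at x" using that by (intro at_within_interior) simp
    then show ?thesis using prim_has_derivative[OF continuous_on_slope, of x u] that by simp
  qed
  then have "\<exists>z>0. z < 1 \<and> (?P has_real_derivative 0) (at z)"
    using \<open>?P 0 = ?P 1\<close>
    by (intro Rolle continuous_on_prim) (auto simp: real_differentiable_def)
  then show thesis using that d DERIV_unique by (metis atLeastAtMost_iff less_imp_le)
qed

text \<open>The Hoelder estimate for u', started from a zero of u'. The sup bound it gives is what
  makes the quasilinear energy differentiable on this space.\<close>

lemma abs_slope_le:
  assumes "x \<in> {0..1}" shows "\<bar>slope u x\<bar> \<le> norm u"
proof -
  obtain y where y: "y \<in> {0..1}" "slope u y = 0" by (rule slope_eq_0)
  have "sqrt \<bar>x - y\<bar> \<le> 1" using assms y by (simp add: abs_le_iff)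
  then have "norm (second_deriv u) * sqrt \<bar>x - y\<bar> \<le> norm (second_deriv u)" by (simp add: mult_left_le)
  moreover have "slope u x = prim (second_deriv u) x - prim (second_deriv u) y"
    using y by (simp add: slope_def)
  ultimately show ?thesis
    using abs_prim_diff_le[of "second_deriv u" x y] by (simp add: norm_navier_space_def)
qed

lemma norm_slope_le: "norm (abs_L2 (slope u)) \<le> norm u"
  by (rule norm_abs_L2_bound[OF square_integrable_slope abs_slope_le]) auto

lemma norm_to_L2_le: "norm (to_L2 u) \<le> norm u"
  unfolding to_L2_eq_prim using norm_abs_L2_prim_le norm_slope_le by (rule order_trans)

lemma abs_fun_of_to_L2_le: "AE x in unit_itv. \<bar>fun_of (to_L2 u) x\<bar> \<le> norm u"
proof -
  have "AE x in unit_itv. fun_of (to_L2 u) x = prim (abs_L2 (slope u)) x"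
    unfolding to_L2_eq_prim by (rule fun_of_abs[OF square_integrable_prim])
  then show ?thesis
    using AE_space
  proof eventually_elim
    case (elim x)
    then show ?case using abs_prim_le[of x "abs_L2 (slope u)"] norm_slope_le[of u] by simp
  qed
qed

section \<open>Differentiability of the elastic energy\<close>

lemma real_lipschitz_of_deriv_bound:
  fixes f :: "real \<Rightarrow> real"
  assumes "\<And>x. (f has_real_derivative f' x) (at x)" "\<And>x. \<bar>f' x\<bar> \<le> B"
  shows "\<bar>f x - f y\<bar> \<le> B * \<bar>x - y\<bar>"
  using field_differentiable_bound[of UNIV f f' B x y] assms by simp

lemma DERIV_1_plus_square_powr:
  "((\<lambda>p::real. (1 + p\<^sup>2) powr a) has_real_derivative 2 * a * p * (1 + p\<^sup>2) powr (a - 1)) (at p)"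
proof -
  have "1 + p\<^sup>2 > 0" by (simp add: add_pos_nonneg)
  then show ?thesis by (auto intro!: derivative_eq_intros)
qed

lemma one_plus_square_powr_le_1: "a \<le> 0 \<Longrightarrow> (1 + p\<^sup>2) powr a \<le> (1::real)"
proof -
  assume "a \<le> 0"
  then have "(1 + p\<^sup>2) powr a \<le> (1 + p\<^sup>2) powr 0" by (intro powr_mono) auto
  moreover have "1 + p\<^sup>2 \<noteq> 0" using zero_le_power2[of p] by linarith
  ultimately show ?thesis by simp
qed

text \<open>One power of 1 + p^2 absorbs the factor \<open>m\<close>; the derivatives of the weights
  below have \<open>m\<close> equal to p or p^2.\<close>

lemma abs_mult_powr_le:
  fixes p :: real
  assumes "\<bar>m\<bar> \<le> 1 + p\<^sup>2" "a \<le> -1"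
  shows "\<bar>m * (1 + p\<^sup>2) powr a\<bar> \<le> 1"
proof -
  have pos: "1 + p\<^sup>2 > 0" by (simp add: add_pos_nonneg)
  have "\<bar>m * (1 + p\<^sup>2) powr a\<bar> \<le> (1 + p\<^sup>2) * (1 + p\<^sup>2) powr a"
    using assms(1) by (simp add: abs_mult mult_right_mono)
  also have "\<dots> = (1 + p\<^sup>2) powr (1 + a)" using pos by (simp add: powr_add)
  also have "\<dots> \<le> 1" using assms(2) by (intro one_plus_square_powr_le_1) simp
  finally show ?thesis .
qed

lemma abs_le_one_plus_square: "\<bar>p\<bar> \<le> 1 + (p::real)\<^sup>2"
proof -
  have "0 \<le> (\<bar>p\<bar> - 1)\<^sup>2 + \<bar>p\<bar>" by simp
  then show ?thesis by (simp add: power2_eq_square algebra_simps)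
qed

definition wt :: "real \<Rightarrow> real" where "wt p = (1 + p\<^sup>2) powr (- 5 / 2)"

definition wt' :: "real \<Rightarrow> real" where "wt' p = - 5 * (p * (1 + p\<^sup>2) powr (- 7 / 2))"

lemma wt_bounds: "0 < wt p" "wt p \<le> 1"
proof -
  have "1 + p\<^sup>2 > 0" by (simp add: add_pos_nonneg)
  then show "0 < wt p" by (simp add: wt_def)
  show "wt p \<le> 1" unfolding wt_def by (rule one_plus_square_powr_le_1) simp
qed

lemma DERIV_wt: "(wt has_real_derivative wt' p) (at p)"
  unfolding wt_def[abs_def] wt'_def using DERIV_1_plus_square_powr[of "-5/2" p] by (simp add: mult.assoc)

lemma abs_wt'_le: "\<bar>wt' p\<bar> \<le> 5"
  using abs_mult_powr_le[OF abs_le_one_plus_square, of "-7/2" p] by (simp add: wt'_def abs_mult)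

text \<open>The derivative of \<open>wt'\<close> has two terms, each bounded by the size of its
  coefficient: 5 + 35 = 40.\<close>

lemma wt'_lipschitz: "\<bar>wt' p - wt' r\<bar> \<le> 40 * \<bar>p - r\<bar>"
proof (rule real_lipschitz_of_deriv_bound)
  fix x :: real
  have "(wt' has_real_derivative
      - 5 * (1 * (1 + x\<^sup>2) powr (- 7 / 2) + 2 * (- 7 / 2) * x * (1 + x\<^sup>2) powr (- 7 / 2 - 1) * x)) (at x)"
    unfolding wt'_def[abs_def] by (intro DERIV_cmult DERIV_mult DERIV_ident DERIV_1_plus_square_powr)
  then show "(wt' has_real_derivative
      - 5 * (1 + x\<^sup>2) powr (- 7 / 2) + 35 * (x\<^sup>2 * (1 + x\<^sup>2) powr (- 9 / 2))) (at x)"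
    by (simp add: power2_eq_square algebra_simps)
  have "\<bar>x\<^sup>2 * (1 + x\<^sup>2) powr (- 9 / 2)\<bar> \<le> 1"
    by (rule abs_mult_powr_le) auto
  moreover have "(1 + x\<^sup>2) powr (- 7 / 2) \<le> 1" by (rule one_plus_square_powr_le_1) simp
  moreover have "0 \<le> (1 + x\<^sup>2) powr (- 7 / 2)" by simp
  ultimately show "\<bar>- 5 * (1 + x\<^sup>2) powr (- 7 / 2) + 35 * (x\<^sup>2 * (1 + x\<^sup>2) powr (- 9 / 2))\<bar> \<le> 40"
    by linarith
qed

lemma wt_lipschitz: "\<bar>wt p - wt r\<bar> \<le> 5 * \<bar>p - r\<bar>"
  by (rule real_lipschitz_of_deriv_bound[OF DERIV_wt abs_wt'_le])

text \<open>The mean value inequality for \<open>wt x - wt' p * x\<close> on the ball of radius |s|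
  around p, where the derivative is at most 40 |s| because \<open>wt'\<close> is Lipschitz.\<close>

lemma wt_taylor: "\<bar>wt (p + s) - wt p - wt' p * s\<bar> \<le> 40 * s\<^sup>2"
proof -
  have "norm ((wt (p + s) - wt' p * (p + s)) - (wt p - wt' p * p)) \<le> (40 * \<bar>s\<bar>) * norm ((p + s) - p)"
  proof (rule field_differentiable_bound[of "cball p \<bar>s\<bar>" "\<lambda>x. wt x - wt' p * x" "\<lambda>x. wt' x - wt' p"])
    fix x assume x: "x \<in> cball p \<bar>s\<bar>"
    show "((\<lambda>x. wt x - wt' p * x) has_real_derivative wt' x - wt' p) (at x within cball p \<bar>s\<bar>)"
      by (rule has_field_derivative_at_within) (auto intro!: derivative_eq_intros DERIV_wt)
    show "norm (wt' x - wt' p) \<le> 40 * \<bar>s\<bar>"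
      using wt'_lipschitz[of x p] x by (simp add: dist_real_def abs_minus_commute)
  qed (auto simp: dist_real_def)
  then show ?thesis by (simp add: algebra_simps power2_eq_square flip: abs_mult)
qed

lemma continuous_on_wt: "continuous_on S wt"
  by (meson DERIV_isCont DERIV_wt continuous_at_imp_continuous_on)

lemma continuous_on_wt': "continuous_on S wt'"
proof -
  have "1 + p\<^sup>2 \<noteq> 0" for p :: real by (metis add_pos_nonneg less_irrefl zero_le_power2 zero_less_one)
  then show ?thesis unfolding wt'_def[abs_def] by (intro continuous_intros) auto
qed

section \<open>The energy and its first variation\<close>

lemma measurable_comp_continuous:
  fixes f :: "real \<Rightarrow> real"
  assumes "continuous_on UNIV f" "continuous_on {0..1} p"
  shows "(\<lambda>x. f (p x)) \<in> borel_measurable unit_itv"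
  by (rule square_integrable_measurable, rule square_integrable_continuous)
     (rule continuous_on_compose2[OF assms(1,2)], simp)

lemma integrable_bounded_mult:
  fixes f m :: "real \<Rightarrow> real"
  assumes f: "integrable unit_itv f" and m: "m \<in> borel_measurable unit_itv"
    and bd: "\<And>x. 0 < x \<Longrightarrow> x < 1 \<Longrightarrow> \<bar>m x\<bar> \<le> B"
  shows "integrable unit_itv (\<lambda>x. m x * f x)"
proof (rule Bochner_Integration.integrable_bound)
  have B: "0 \<le> B" using bd[of "1/2"] by simp
  show "integrable unit_itv (\<lambda>x. B * f x)" using f by simp
  show "(\<lambda>x. m x * f x) \<in> borel_measurable unit_itv"
    by (rule borel_measurable_times[OF m borel_measurable_integrable[OF f]])
  show "AE x in unit_itv. norm (m x * f x) \<le> norm (B * f x)"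
    using bd B by (intro AE_I2) (simp add: abs_mult mult_right_mono)
qed

abbreviation curv :: "navier_space \<Rightarrow> real \<Rightarrow> real" where
  "curv u \<equiv> fun_of (second_deriv u)"

lemma norm_navier_space_square: "(norm u)\<^sup>2 = (\<integral>x. (curv u x)\<^sup>2 \<partial>unit_itv)"
proof -
  have "norm u = norm (abs_L2 (curv u))" by (simp add: norm_navier_space_def abs_fun_of)
  then show ?thesis by (simp add: norm_abs_L2[OF square_integrable_fun_of])
qed

lemma integrable_curv_square: "integrable unit_itv (\<lambda>x. (curv u x)\<^sup>2)"
  using square_integrable_fun_of by (simp add: square_integrable_def)

lemma curv_add: "AE x in unit_itv. curv (u + v) x = curv u x + curv v x"
proof -
  have "second_deriv (u + v) = abs_L2 (\<lambda>x. curv u x + curv v x)"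
    unfolding second_deriv_add
    using plus_L2.abs_eq[of "curv u" "curv v"] by (simp add: square_integrable_fun_of abs_fun_of)
  then show ?thesis
    using fun_of_abs[OF square_integrable_add[OF square_integrable_fun_of square_integrable_fun_of]] by simp
qed

lemma measurable_slope:
  "(\<lambda>x. wt (slope u x)) \<in> borel_measurable unit_itv"
  "(\<lambda>x. wt' (slope u x)) \<in> borel_measurable unit_itv"
  by (intro measurable_comp_continuous continuous_on_wt continuous_on_wt' continuous_on_slope)+

lemma integrable_wt_slope:
  assumes "integrable unit_itv f"
  shows "integrable unit_itv (\<lambda>x. wt (slope u x) * f x)"
  by (rule integrable_bounded_mult[OF assms measurable_slope(1), of _ 1])
     (use wt_bounds in \<open>auto simp: abs_of_pos\<close>)

lemma integrable_wt'_slope: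
  assumes "integrable unit_itv f"
  shows "integrable unit_itv (\<lambda>x. wt' (slope u x) * f x)"
  by (rule integrable_bounded_mult[OF assms measurable_slope(2) abs_wt'_le])

lemma integrable_slope_mult:
  assumes "integrable unit_itv f"
  shows "integrable unit_itv (\<lambda>x. slope u x * f x)"
  by (rule integrable_bounded_mult[OF assms square_integrable_measurable[OF square_integrable_slope] abs_slope_le])
     auto

lemma energy_eq: "energy u = (\<integral>x. wt (slope u x) * (curv u x)\<^sup>2 \<partial>unit_itv)"
  unfolding energy_def
proof (rule integral_cong_AE)
  have [measurable]: "curv u \<in> borel_measurable unit_itv"
    "fun_of (weak_deriv (to_L2 u)) \<in> borel_measurable unit_itv"
    by (intro square_integrable_measurable square_integrable_fun_of)+
  show "(\<lambda>x. (curv u x)\<^sup>2 / (1 + (fun_of (weak_deriv (to_L2 u)) x)\<^sup>2) powr (5 / 2)) \<in> borel_measurable unit_itv"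
    by measurable
  show "(\<lambda>x. wt (slope u x) * (curv u x)\<^sup>2) \<in> borel_measurable unit_itv"
    by (intro borel_measurable_integrable integrable_wt_slope integrable_curv_square)
  show "AE x in unit_itv. (curv u x)\<^sup>2 / (1 + (fun_of (weak_deriv (to_L2 u)) x)\<^sup>2) powr (5 / 2)
      = wt (slope u x) * (curv u x)\<^sup>2"
    using fun_of_weak_deriv_to_L2[of u]
  proof eventually_elim
    case (elim x)
    show ?case
      unfolding elim wt_def using powr_minus_divide[of "1 + (slope u x)\<^sup>2" "5/2"] by simp
  qed
qed

text \<open>What formal differentiation of the integrand \<open>wt\<close> (u') u''^2 in direction
  \<open>h\<close> gives.\<close>

definition energy_deriv :: "navier_space \<Rightarrow> navier_space \<Rightarrow> real" where
  "energy_deriv u h = (\<integral>x. wt (slope u x) * (2 * curv u x * curv h x)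
     + wt' (slope u x) * (slope h x * (curv u x)\<^sup>2) \<partial>unit_itv)"

lemma integrable_energy_deriv:
  "integrable unit_itv (\<lambda>x. wt (slope u x) * (2 * curv u x * curv h x))"
  "integrable unit_itv (\<lambda>x. wt' (slope u x) * (slope h x * (curv u x)\<^sup>2))"
proof -
  have "integrable unit_itv (\<lambda>x. 2 * (curv u x * curv h x))"
    by (intro integrable_mult_right square_integrable_mult square_integrable_fun_of)
  then show "integrable unit_itv (\<lambda>x. wt (slope u x) * (2 * curv u x * curv h x))"
    by (intro integrable_wt_slope) (simp add: mult.assoc)
  show "integrable unit_itv (\<lambda>x. wt' (slope u x) * (slope h x * (curv u x)\<^sup>2))"
    by (intro integrable_wt'_slope integrable_slope_mult integrable_curv_square)
qed

text \<open>The two terms are bounded for different reasons. The one with h'' is an inner product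
  with a fixed square integrable function. In the one with h' the factor u''^2 is merely integrable,
  so h' has to be bounded uniformly.\<close>

lemma bounded_linear_energy_deriv: "bounded_linear (energy_deriv u)"
proof -
  define A where "A = abs_L2 (\<lambda>x. wt (slope u x) * curv u x)"
  define B where "B h = (\<integral>x. slope h x * (wt' (slope u x) * (curv u x)\<^sup>2) \<partial>unit_itv)" for h
  have sqA: "square_integrable (\<lambda>x. wt (slope u x) * curv u x)"
    by (rule square_integrable_times_bounded(1)[OF square_integrable_fun_of measurable_slope(1), of _ 1])
       (use wt_bounds in \<open>auto simp: abs_of_pos\<close>)
  have int: "integrable unit_itv (\<lambda>x. wt' (slope u x) * (curv u x)\<^sup>2)"
    by (intro integrable_wt'_slope integrable_curv_square)
  have A: "inner A (second_deriv h) = (\<integral>x. wt (slope u x) * curv u x * curv h x \<partial>unit_itv)" for h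
    using inner_abs_L2[OF sqA square_integrable_fun_of[of "second_deriv h"]] by (simp add: A_def abs_fun_of)
  have eq: "energy_deriv u h = 2 * inner A (second_deriv h) + B h" for h
  proof -
    have "energy_deriv u h = (\<integral>x. wt (slope u x) * (2 * curv u x * curv h x) \<partial>unit_itv)
        + (\<integral>x. wt' (slope u x) * (slope h x * (curv u x)\<^sup>2) \<partial>unit_itv)"
      unfolding energy_deriv_def
      by (rule Bochner_Integration.integral_add[OF integrable_energy_deriv])
    also have "(\<integral>x. wt (slope u x) * (2 * curv u x * curv h x) \<partial>unit_itv) = 2 * inner A (second_deriv h)"
      unfolding A by (subst Bochner_Integration.integral_mult_right_zero[symmetric]) (simp add: mult_ac)
    finally show ?thesis by (simp add: B_def mult_ac)
  qed
  have "bounded_linear B"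
  proof (rule bounded_linear_intro)
    show "B (h + k) = B h + B k" for h k
      unfolding B_def slope_add distrib_right
      by (intro Bochner_Integration.integral_add integrable_slope_mult int)
    show "B (c *\<^sub>R h) = c *\<^sub>R B h" for c h
      unfolding B_def slope_scaleR by (simp add: mult.assoc)
    show "norm (B h) \<le> norm h * (\<integral>x. \<bar>wt' (slope u x) * (curv u x)\<^sup>2\<bar> \<partial>unit_itv)" for h
    proof -
      have "norm (B h) \<le> (\<integral>x. norm h * \<bar>wt' (slope u x) * (curv u x)\<^sup>2\<bar> \<partial>unit_itv)"
        unfolding B_def real_norm_def
      proof (rule order_trans[OF integral_abs_bound integral_mono])
        show "integrable unit_itv (\<lambda>x. \<bar>slope h x * (wt' (slope u x) * (curv u x)\<^sup>2)\<bar>)"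
          by (intro integrable_abs integrable_slope_mult int)
        show "integrable unit_itv (\<lambda>x. norm h * \<bar>wt' (slope u x) * (curv u x)\<^sup>2\<bar>)"
          by (intro integrable_mult_right integrable_abs int)
        show "\<bar>slope h x * (wt' (slope u x) * (curv u x)\<^sup>2)\<bar> \<le> norm h * \<bar>wt' (slope u x) * (curv u x)\<^sup>2\<bar>"
          if "x \<in> space unit_itv" for x
          using abs_slope_le[of x h] that unfolding abs_mult[of "slope h x"]
          by (intro mult_right_mono) auto
      qed
      then show ?thesis by simp
    qed
  qed
  moreover have "bounded_linear (\<lambda>h. inner A (second_deriv h))"
  proof (rule bounded_linear_intro)
    show "norm (inner A (second_deriv h)) \<le> norm h * norm A" for h
      using Cauchy_Schwarz_ineq2[of A "second_deriv h"] by (simp add: norm_navier_space_def mult.commute)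
  qed (simp_all add: second_deriv_add second_deriv_scaleR inner_add_right)
  ultimately have "bounded_linear (\<lambda>h. 2 * inner A (second_deriv h) + B h)"
    by (intro bounded_linear_add bounded_linear_const_mult)
  then show ?thesis by (simp add: eq[abs_def])
qed

lemma energy_taylor:
  "\<bar>energy (u + h) - energy u - energy_deriv u h\<bar> \<le> (45 * (norm u)\<^sup>2 + 6) * (norm h)\<^sup>2"
proof -
  let ?p = "slope u" and ?s = "slope h" and ?q = "curv u" and ?r = "curv h"
  let ?R = "\<lambda>x. wt (slope (u + h) x) * (curv (u + h) x)\<^sup>2 - wt (?p x) * (?q x)\<^sup>2
    - (wt (?p x) * (2 * ?q x * ?r x) + wt' (?p x) * (?s x * (?q x)\<^sup>2))"
  have int: "integrable unit_itv (\<lambda>x. wt (slope (u + h) x) * (curv (u + h) x)\<^sup>2)"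
      "integrable unit_itv (\<lambda>x. wt (?p x) * (?q x)\<^sup>2)"
      "integrable unit_itv (\<lambda>x. wt (?p x) * (2 * ?q x * ?r x) + wt' (?p x) * (?s x * (?q x)\<^sup>2))"
    by (intro integrable_wt_slope integrable_curv_square Bochner_Integration.integrable_add integrable_energy_deriv)+
  have eq: "energy (u + h) - energy u - energy_deriv u h = (\<integral>x. ?R x \<partial>unit_itv)"
    unfolding energy_eq energy_deriv_def using int by simp
  have "\<bar>\<integral>x. ?R x \<partial>unit_itv\<bar> \<le> (\<integral>x. 45 * (norm h)\<^sup>2 * (?q x)\<^sup>2 + 6 * (?r x)\<^sup>2 \<partial>unit_itv)"
  proof (rule order_trans[OF integral_abs_bound integral_mono_AE])
    show "integrable unit_itv (\<lambda>x. \<bar>?R x\<bar>)" using int by simp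
    show "integrable unit_itv (\<lambda>x. 45 * (norm h)\<^sup>2 * (?q x)\<^sup>2 + 6 * (?r x)\<^sup>2)"
      by (intro Bochner_Integration.integrable_add integrable_mult_right integrable_curv_square)
    show "AE x in unit_itv. \<bar>?R x\<bar> \<le> 45 * (norm h)\<^sup>2 * (?q x)\<^sup>2 + 6 * (?r x)\<^sup>2"
      using curv_add[of u h] AE_space
    proof eventually_elim
      case (elim x)
      define p q r s where "p = ?p x" "q = ?q x" "r = ?r x" "s = ?s x"
      note pqrs = this
      \<comment> \<open>Sorted by powers of the increment r of u'': the Taylor remainder of the
        weight meets q^2, its first difference meets q r, its value meets r^2. The bounds add up to
        the constants 45 = 40 + 5 and 6 = 5 + 1.\<close>
      have R: "?R x = q\<^sup>2 * (wt (p + s) - wt p - wt' p * s) + 2 * (q * r) * (wt (p + s) - wt p) + r\<^sup>2 * wt (p + s)"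
        unfolding slope_add elim(1) pqrs[symmetric] by (simp add: power2_sum algebra_simps)
      have s: "s\<^sup>2 \<le> (norm h)\<^sup>2"
        using abs_slope_le[of x h] elim(2) by (simp add: pqrs abs_le_square_iff[symmetric])
      have A: "\<bar>q\<^sup>2 * (wt (p + s) - wt p - wt' p * s)\<bar> \<le> q\<^sup>2 * (40 * s\<^sup>2)"
        using wt_taylor[of p s] by (simp add: abs_mult mult_left_mono)
      have "\<bar>2 * (q * r) * (wt (p + s) - wt p)\<bar> \<le> \<bar>2 * (q * r)\<bar> * (5 * \<bar>s\<bar>)"
        using wt_lipschitz[of "p + s" p] unfolding abs_mult[of "2 * (q * r)"]
        by (intro mult_left_mono) auto
      \<comment> \<open>Young's inequality 2ab \<le> a^2 + b^2 with a = |q||s| and b = |r|.\<close>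
      also have "\<dots> \<le> 5 * (q\<^sup>2 * s\<^sup>2) + 5 * r\<^sup>2"
        using zero_le_power2[of "\<bar>q\<bar> * \<bar>s\<bar> - \<bar>r\<bar>"]
        by (simp add: power2_diff abs_mult power_mult_distrib algebra_simps)
      finally have B: "\<bar>2 * (q * r) * (wt (p + s) - wt p)\<bar> \<le> 5 * (q\<^sup>2 * s\<^sup>2) + 5 * r\<^sup>2" .
      have C: "\<bar>r\<^sup>2 * wt (p + s)\<bar> \<le> r\<^sup>2"
        using wt_bounds[of "p + s"] by (simp add: abs_mult mult_left_le)
      have "q\<^sup>2 * s\<^sup>2 \<le> q\<^sup>2 * (norm h)\<^sup>2" using s by (rule mult_left_mono) simp
      then have "q\<^sup>2 * (40 * s\<^sup>2) + (5 * (q\<^sup>2 * s\<^sup>2) + 5 * r\<^sup>2) + r\<^sup>2 \<le> 45 * (norm h)\<^sup>2 * q\<^sup>2 + 6 * r\<^sup>2"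
        by (simp add: mult_ac)
      moreover have "\<bar>?R x\<bar> \<le> q\<^sup>2 * (40 * s\<^sup>2) + (5 * (q\<^sup>2 * s\<^sup>2) + 5 * r\<^sup>2) + r\<^sup>2"
        unfolding R by (rule order_trans[OF abs_triangle_ineq add_mono[OF order_trans[OF abs_triangle_ineq add_mono[OF A B]] C]])
      ultimately have "\<bar>?R x\<bar> \<le> 45 * (norm h)\<^sup>2 * q\<^sup>2 + 6 * r\<^sup>2" by (rule order_trans[rotated])
      then show ?case by (simp only: pqrs)
    qed
  qed
  also have "\<dots> = (\<integral>x. 45 * (norm h)\<^sup>2 * (?q x)\<^sup>2 \<partial>unit_itv) + (\<integral>x. 6 * (?r x)\<^sup>2 \<partial>unit_itv)"
    by (intro Bochner_Integration.integral_add integrable_mult_right integrable_curv_square)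
  also have "\<dots> = 45 * (norm h)\<^sup>2 * (norm u)\<^sup>2 + 6 * (norm h)\<^sup>2"
    by (simp only: integral_mult_right_zero norm_navier_space_square[symmetric])
  also have "\<dots> = (45 * (norm u)\<^sup>2 + 6) * (norm h)\<^sup>2" by (simp add: algebra_simps)
  finally show ?thesis unfolding eq .
qed

lemma energy_has_derivative: "(energy has_derivative energy_deriv u) (at u)"
  unfolding has_derivative_at
proof
  show "bounded_linear (energy_deriv u)" by (rule bounded_linear_energy_deriv)
  let ?C = "45 * (norm u)\<^sup>2 + 6"
  have "((\<lambda>h::navier_space. ?C * norm h) \<longlongrightarrow> 0) (at 0)"
    by (intro tendsto_mult_right_zero tendsto_norm_zero tendsto_ident_at)
  then show "((\<lambda>h. norm (energy (u + h) - energy u - energy_deriv u h) / norm h) \<longlongrightarrow> 0) (at 0)"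
  proof (rule Lim_null_comparison[rotated], intro always_eventually allI)
    fix h :: navier_space
    show "norm (norm (energy (u + h) - energy u - energy_deriv u h) / norm h) \<le> ?C * norm h"
    proof (cases "h = 0")
      case False
      then show ?thesis
        using energy_taylor[of u h] by (simp add: divide_le_eq power2_eq_square mult.assoc)
    qed simp
  qed
qed

text \<open>\<open>frechet_derivative\<close> is a choice operator; uniqueness of derivatives makes
  the term in \<open>FVI_gradient_flow\<close> an explicit integral.\<close>

lemma frechet_derivative_energy: "frechet_derivative energy (at u) = energy_deriv u"
  using frechet_derivative_at[OF energy_has_derivative] by simp

lemma energy_deriv_self_ge:
  assumes s0: "0 \<le> s0" "s0\<^sup>2 \<le> 2 / 3" and slope: "\<And>x. x \<in> {0..1} \<Longrightarrow> \<bar>slope u x\<bar> \<le> s0"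
  shows "wt s0 * (2 - 5 * s0\<^sup>2 / (1 + s0\<^sup>2)) * (norm u)\<^sup>2 \<le> energy_deriv u u"
proof -
  let ?c = "\<lambda>p::real. 2 - 5 * p\<^sup>2 / (1 + p\<^sup>2)"
  have pos: "1 + p\<^sup>2 > 0" for p :: real by (simp add: add_pos_nonneg)
  \<comment> \<open>This form shows that the factor decreases in p^2 and is nonnegative exactly for
    p^2 \<le> 2/3.\<close>
  have c: "?c p = 5 / (1 + p\<^sup>2) - 3" for p using pos[of p] by (simp add: field_simps)
  have c0: "?c s0 \<ge> 0" unfolding c using pos[of s0] s0 by (simp add: field_simps)
  have "wt s0 * ?c s0 * (norm u)\<^sup>2 = (\<integral>x. wt s0 * ?c s0 * (curv u x)\<^sup>2 \<partial>unit_itv)"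
    by (simp only: norm_navier_space_square integral_mult_right_zero)
  also have "\<dots> \<le> energy_deriv u u"
    unfolding energy_deriv_def
  proof (rule integral_mono)
    show "integrable unit_itv (\<lambda>x. wt s0 * ?c s0 * (curv u x)\<^sup>2)"
      by (intro integrable_mult_right integrable_curv_square)
    show "integrable unit_itv (\<lambda>x. wt (slope u x) * (2 * curv u x * curv u x) + wt' (slope u x) * (slope u x * (curv u x)\<^sup>2))"
      by (intro Bochner_Integration.integrable_add integrable_energy_deriv)
    fix x assume "x \<in> space unit_itv"
    define p where "p = slope u x"
    have "\<bar>p\<bar> \<le> \<bar>s0\<bar>" using slope[of x] \<open>x \<in> _\<close> s0 by (simp add: p_def)
    then have p: "p\<^sup>2 \<le> s0\<^sup>2" by (simp add: abs_le_square_iff)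
    have "wt s0 \<le> wt p"
      unfolding wt_def using p pos by (intro powr_mono2') auto
    moreover have "?c s0 \<le> ?c p"
      unfolding c using p pos by (intro diff_right_mono divide_left_mono) auto
    ultimately have "wt s0 * ?c s0 \<le> wt p * ?c p"
      using c0 wt_bounds(1) by (intro mult_mono) (auto intro: less_imp_le)
    moreover have "wt p * (2 * q * q) + wt' p * (p * q\<^sup>2) = wt p * ?c p * q\<^sup>2" for q
    proof -
      have "wt' p * (1 + p\<^sup>2) = - 5 * p * wt p"
        using powr_add[of "1 + p\<^sup>2" "-7/2" 1] pos[of p] by (simp add: wt'_def wt_def mult.commute)
      then have "wt' p = - 5 * p * wt p / (1 + p\<^sup>2)"
        using pos[of p] by (subst nonzero_eq_divide_eq) auto
      then show ?thesis by (simp add: power2_eq_square algebra_simps)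
    qed
    ultimately show "wt s0 * ?c s0 * (curv u x)\<^sup>2
        \<le> wt (slope u x) * (2 * curv u x * curv u x) + wt' (slope u x) * (slope u x * (curv u x)\<^sup>2)"
      unfolding p_def[symmetric] by (simp add: mult_right_mono del: mult_le_cancel_right)
  qed
  finally show ?thesis .
qed

section \<open>The energy controls the slope\<close>

text \<open>Both the integrand of G and the square root of \<open>wt\<close>. Hence the formal
  derivative of G(u') is \<open>sqwt\<close> (u') u'', whose squared norm is the energy.\<close>

definition sqwt :: "real \<Rightarrow> real" where "sqwt p = (1 + p\<^sup>2) powr (- 5 / 4)"

lemma sqwt_bounds: "0 < sqwt p" "sqwt p \<le> 1"
proof -
  have "1 + p\<^sup>2 > 0" by (simp add: add_pos_nonneg)
  then show "0 < sqwt p" by (simp add: sqwt_def)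
  show "sqwt p \<le> 1" unfolding sqwt_def by (rule one_plus_square_powr_le_1) simp
qed

lemma sqwt_square: "(sqwt p)\<^sup>2 = wt p"
  unfolding power2_eq_square sqwt_def wt_def powr_add[symmetric] by simp

lemma sqwt_minus: "sqwt (- p) = sqwt p"
  by (simp add: sqwt_def)

lemma sqwt_lipschitz: "\<bar>sqwt p - sqwt r\<bar> \<le> 5 / 2 * \<bar>p - r\<bar>"
proof (rule real_lipschitz_of_deriv_bound)
  fix x
  show "(sqwt has_real_derivative - 5 / 2 * (x * (1 + x\<^sup>2) powr (- 9 / 4))) (at x)"
    unfolding sqwt_def[abs_def] using DERIV_1_plus_square_powr[of "-5/4" x] by (simp add: mult.assoc)
  show "\<bar>- 5 / 2 * (x * (1 + x\<^sup>2) powr (- 9 / 4))\<bar> \<le> 5 / 2"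
    using abs_mult_powr_le[OF abs_le_one_plus_square, of "-9/4" x] by (simp add: abs_mult)
qed

lemma continuous_on_sqwt: "continuous_on S sqwt"
proof -
  have "1 + p\<^sup>2 \<noteq> 0" for p :: real by (metis add_pos_nonneg less_irrefl zero_le_power2 zero_less_one)
  then show ?thesis unfolding sqwt_def[abs_def] by (intro continuous_intros) auto
qed

section \<open>The function G\<close>

lemma G_fun_0: "G_fun 0 = 0"
  by (simp add: G_fun_def zero_ereal_def[symmetric] interval_integral_endpoints_same)

lemma DERIV_G_fun: "(G_fun has_real_derivative sqwt s) (at s)"
proof -
  have "isCont sqwt x" for x
    using continuous_on_sqwt[of UNIV] by (simp add: continuous_on_eq_continuous_at)
  then obtain F where F: "\<And>x. (F has_vector_derivative sqwt x) (at x)"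
    using einterval_antiderivative[of "-\<infinity>" "\<infinity>" sqwt] by auto
  have "G_fun s = F s - F 0" for s
    unfolding G_fun_def zero_ereal_def sqwt_def[symmetric]
    by (intro interval_integral_FTC_finite continuous_on_sqwt has_vector_derivative_at_within[OF F])
  then have "G_fun = (\<lambda>s. F s - F 0)" by auto
  then show ?thesis
    using DERIV_diff[OF _ DERIV_const, of F "sqwt s" s UNIV "F 0"] F[of s]
    by (simp add: has_real_derivative_iff_has_vector_derivative)
qed

lemma G_fun_strict_mono: "s < t \<Longrightarrow> G_fun s < G_fun t"
  using DERIV_pos_imp_increasing[of s t G_fun] DERIV_G_fun sqwt_bounds(1) by blast

lemma G_fun_minus: "G_fun (- s) = - G_fun s"
proof -
  have "((\<lambda>s. G_fun s + G_fun (- s)) has_real_derivative sqwt x + sqwt (- x) * - 1) (at x)" for x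
    by (intro DERIV_add DERIV_G_fun DERIV_chain2[OF DERIV_G_fun]) (auto intro!: derivative_eq_intros)
  then have "\<forall>x. ((\<lambda>s. G_fun s + G_fun (- s)) has_real_derivative 0) (at x)"
    by (simp add: sqwt_minus)
  then have "G_fun s + G_fun (- s) = G_fun 0 + G_fun (- 0)"
    by (rule DERIV_isconst_all)
  then show ?thesis by (simp add: G_fun_0)
qed

lemma abs_le_if_abs_G_fun_le:
  assumes "\<bar>G_fun p\<bar> \<le> G_fun s" shows "\<bar>p\<bar> \<le> s"
  using assms G_fun_strict_mono[of s p] G_fun_strict_mono[of p "- s"]
  by (force simp: G_fun_minus abs_le_iff)

section \<open>The chain rule for G by density\<close>

lemma measurable_sqwt_prim: "(\<lambda>t. sqwt (c + prim v t)) \<in> borel_measurable unit_itv"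
  by (rule measurable_comp_continuous[OF continuous_on_sqwt]) (intro continuous_intros continuous_on_prim)

lemma square_integrable_sqwt_prim:
  "square_integrable f \<Longrightarrow> square_integrable (\<lambda>t. sqwt (c + prim v t) * f t)"
  by (rule square_integrable_times_bounded(1)[OF _ measurable_sqwt_prim, of _ _ _ 1])
     (use sqwt_bounds in \<open>auto simp: abs_of_pos\<close>)

text \<open>The coefficient converges uniformly, since \<open>sqwt\<close> is Lipschitz and
  primitives are controlled in sup norm, while the other factor converges in \<open>L2\<close>. This
  is the continuity that the density argument below needs.\<close>

lemma tendsto_sqwt_prim:
  assumes "v \<longlonglongrightarrow> w"
  shows "(\<lambda>n. abs_L2 (\<lambda>t. sqwt (c + prim (v n) t) * fun_of (v n) t))
    \<longlonglongrightarrow> abs_L2 (\<lambda>t. sqwt (c + prim w t) * fun_of w t)"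
proof -
  define k where "k v t = sqwt (c + prim v t)" for v t
  have mk: "k v \<in> borel_measurable unit_itv" for v
    unfolding k_def by (rule measurable_sqwt_prim)
  have k1: "\<bar>k v t\<bar> \<le> 1" for v t using sqwt_bounds[of "c + prim v t"] by (simp add: k_def)
  have kd: "\<bar>k v t - k w t\<bar> \<le> 5 / 2 * norm (v - w)" if "0 < t" "t < 1" for v t
    using sqwt_lipschitz[of "c + prim v t" "c + prim w t"] abs_prim_le[of t "v - w"] that
    by (simp add: k_def prim_diff)
  have sq: "square_integrable (\<lambda>t. k v t * f t)" if "square_integrable f" for v f
    unfolding k_def by (rule square_integrable_sqwt_prim[OF that])
  note sqf = square_integrable_fun_of
  have le: "norm (abs_L2 (\<lambda>t. k v t * fun_of v t) - abs_L2 (\<lambda>t. k w t * fun_of w t))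
      \<le> norm (v - w) + 5 / 2 * norm (v - w) * norm w" for v
  proof -
    let ?d = "\<lambda>t. fun_of v t - fun_of w t"
    have sqd: "square_integrable ?d" by (intro square_integrable_diff sqf)
    have absd: "abs_L2 ?d = v - w" by (simp add: diff_abs_L2[symmetric] sqf abs_fun_of)
    have mkd: "(\<lambda>t. k v t - k w t) \<in> borel_measurable unit_itv"
      by (intro borel_measurable_diff mk)
    have bd: "square_integrable (\<lambda>t. (k v t - k w t) * fun_of w t)"
      "norm (abs_L2 (\<lambda>t. (k v t - k w t) * fun_of w t)) \<le> 5 / 2 * norm (v - w) * norm (abs_L2 (fun_of w))"
      using square_integrable_times_bounded[OF sqf[of w] mkd kd] by auto
    \<comment> \<open>The bounded coefficient goes with the difference of the functions, and the
      small coefficient difference with the fixed limit \<open>w\<close>.\<close>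
    have "abs_L2 (\<lambda>t. k v t * fun_of v t) - abs_L2 (\<lambda>t. k w t * fun_of w t)
        = abs_L2 (\<lambda>t. k v t * ?d t + (k v t - k w t) * fun_of w t)"
      unfolding diff_abs_L2[OF sq[OF sqf] sq[OF sqf]] by (simp add: algebra_simps)
    also have "\<dots> = abs_L2 (\<lambda>t. k v t * ?d t) + abs_L2 (\<lambda>t. (k v t - k w t) * fun_of w t)"
      by (simp add: plus_L2.abs_eq sq sqd bd)
    also have "norm \<dots> \<le> norm (v - w) + 5 / 2 * norm (v - w) * norm w"
      using square_integrable_times_bounded(2)[OF sqd mk[of v] k1] bd(2)
      by (intro order_trans[OF norm_triangle_ineq] add_mono) (simp_all add: absd abs_fun_of)
    finally show ?thesis .
  qed
  have "(\<lambda>n. norm (v n - w)) \<longlonglongrightarrow> 0" using assms by (simp add: tendsto_norm_zero LIM_zero)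
  then have "(\<lambda>n. norm (v n - w) + 5 / 2 * norm (v n - w) * norm w) \<longlonglongrightarrow> 0 + 5 / 2 * 0 * norm w"
    by (intro tendsto_intros)
  then have "(\<lambda>n. norm (v n - w) + 5 / 2 * norm (v n - w) * norm w) \<longlonglongrightarrow> 0" by simp
  then have "(\<lambda>n. abs_L2 (\<lambda>t. k (v n) t * fun_of (v n) t) - abs_L2 (\<lambda>t. k w t * fun_of w t)) \<longlonglongrightarrow> 0"
    by (rule Lim_null_comparison[rotated]) (use le in auto)
  then show ?thesis by (simp add: LIM_zero_iff k_def)
qed

text \<open>
  For continuous \<open>v\<close> this is the chain rule; both sides depend continuously on \<open>v\<close>, so the general
  case follows by density, without a chain rule for absolutely continuous functions.
\<close>

lemma G_fun_prim_diff_le: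
  assumes xy: "x \<in> {0..1}" "y \<in> {0..1}"
  shows "\<bar>G_fun (c + prim v x) - G_fun (c + prim v y)\<bar> \<le> norm (abs_L2 (\<lambda>t. sqwt (c + prim v t) * fun_of v t))"
proof -
  have cont: "\<bar>G_fun (c + prim (abs_L2 f) x) - G_fun (c + prim (abs_L2 f) y)\<bar>
      \<le> norm (abs_L2 (\<lambda>t. sqwt (c + prim (abs_L2 f) t) * fun_of (abs_L2 f) t))"
    if f: "continuous_on {0..1} f" for f
  proof -
    let ?P = "prim (abs_L2 f)" and ?g = "\<lambda>t. sqwt (c + prim (abs_L2 f) t) * f t"
    have g: "continuous_on {0..1} ?g"
      by (intro continuous_intros f continuous_on_compose2[OF continuous_on_sqwt[of UNIV]] continuous_on_prim) auto
    \<comment> \<open>Both functions have derivative \<open>?g\<close>, so the increments of G are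
      increments of a primitive and the Hoelder estimate applies to them.\<close>
    have "\<exists>C. \<forall>t\<in>{0..1}. G_fun (c + ?P t) - prim (abs_L2 ?g) t = C"
    proof (rule has_field_derivative_zero_constant)
      fix t :: real assume t: "t \<in> {0..1}"
      have "((\<lambda>t. c + ?P t) has_real_derivative f t) (at t within {0..1})"
        using DERIV_add[OF DERIV_const prim_has_derivative[OF f t]] by simp
      from DERIV_chain2[OF DERIV_G_fun this] prim_has_derivative[OF g t]
      have "((\<lambda>t. G_fun (c + ?P t) - prim (abs_L2 ?g) t) has_real_derivative ?g t - ?g t) (at t within {0..1})"
        by (rule DERIV_diff)
      then show "((\<lambda>t. G_fun (c + ?P t) - prim (abs_L2 ?g) t) has_real_derivative 0) (at t within {0..1})"
        by simp
    qed simp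
    then obtain C where C: "\<And>t. t \<in> {0..1} \<Longrightarrow> G_fun (c + ?P t) - prim (abs_L2 ?g) t = C" by blast
    have "G_fun (c + ?P x) - G_fun (c + ?P y) = prim (abs_L2 ?g) x - prim (abs_L2 ?g) y"
      using C[OF xy(1)] C[OF xy(2)] by linarith
    also have "\<bar>\<dots>\<bar> \<le> norm (abs_L2 ?g) * sqrt \<bar>x - y\<bar>" by (rule abs_prim_diff_le)
    also have "\<dots> \<le> norm (abs_L2 ?g)"
      using xy by (intro mult_left_le) (auto simp: abs_le_iff)
    also have "abs_L2 ?g = abs_L2 (\<lambda>t. sqwt (c + ?P t) * fun_of (abs_L2 f) t)"
      using fun_of_abs[OF square_integrable_continuous[OF f]]
      by (intro abs_L2_cong square_integrable_sqwt_prim square_integrable_fun_of square_integrable_continuous f)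
         (auto elim: eventually_mono)
    finally show ?thesis .
  qed
  obtain s where s: "(\<lambda>n. abs_L2 (rat_bernstein (s n))) \<longlonglongrightarrow> v" by (rule rat_bernstein_approx)
  have "isCont G_fun z" for z by (rule DERIV_isCont[OF DERIV_G_fun])
  then have lim: "(\<lambda>n. G_fun (c + prim (abs_L2 (rat_bernstein (s n))) z)) \<longlonglongrightarrow> G_fun (c + prim v z)" for z
    unfolding prim_def by (rule isCont_tendsto_compose) (intro tendsto_intros s)
  show ?thesis
  proof (rule tendsto_le[OF sequentially_bot tendsto_norm[OF tendsto_sqwt_prim[OF s, of c]]])
    show "(\<lambda>n. \<bar>G_fun (c + prim (abs_L2 (rat_bernstein (s n))) x) - G_fun (c + prim (abs_L2 (rat_bernstein (s n))) y)\<bar>)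
      \<longlonglongrightarrow> \<bar>G_fun (c + prim v x) - G_fun (c + prim v y)\<bar>"
      by (intro tendsto_rabs tendsto_diff lim)
  qed (use cont[OF continuous_on_rat_bernstein] in simp)
qed

text \<open>Measuring the increment of G(u') from a zero of u', where G vanishes, turns it into a
  bound for the value.\<close>

lemma abs_G_fun_slope_le:
  assumes "x \<in> {0..1}" shows "\<bar>G_fun (slope u x)\<bar> \<le> sqrt (energy u)"
proof -
  obtain y where y: "y \<in> {0..1}" "slope u y = 0" by (rule slope_eq_0)
  define c where "c = - inner one_L2 (abs_L2 (prim (second_deriv u)))"
  have sl: "slope u t = c + prim (second_deriv u) t" for t by (simp add: slope_def c_def)
  have sq: "square_integrable (\<lambda>t. sqwt (slope u t) * curv u t)"
    unfolding sl by (rule square_integrable_sqwt_prim[OF square_integrable_fun_of])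
  have "\<bar>G_fun (slope u x) - G_fun (slope u y)\<bar> \<le> norm (abs_L2 (\<lambda>t. sqwt (slope u t) * curv u t))"
    unfolding sl by (rule G_fun_prim_diff_le[OF assms y(1)])
  also have "\<dots> = sqrt (energy u)"
    by (simp add: norm_abs_L2[OF sq] power_mult_distrib sqwt_square energy_eq)
  finally show ?thesis by (simp add: y G_fun_0)
qed

section \<open>Flows away from the obstacle\<close>

text \<open>The set where f is nonnegative is closed and has full measure in the open interval, so
  it contains that interval and then its closure. The endpoints matter because contact is asked for
  on all of [0,1].\<close>

lemma nonneg_if_AE_unit_itv:
  fixes f :: "real \<Rightarrow> real"
  assumes f: "continuous_on {0..1} f" and ae: "AE x in unit_itv. 0 \<le> f x" and x: "x \<in> {0..1}"
  shows "0 \<le> f x"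
proof -
  let ?C = "{x \<in> {0..1}. 0 \<le> f x}"
  have "?C = {0..1} \<inter> f -` {0..}" by auto
  then have C: "closed ?C"
    using continuous_closed_preimage[OF f closed_atLeastAtMost closed_atLeast[of 0]] by simp
  have ae': "AE x\<in>{0<..<1} in lebesgue. x \<in> ?C"
    using ae by (subst (asm) AE_restrict_space_iff) (auto elim: eventually_mono)
  have "{0<..<1} \<subseteq> ?C"
    using mem_closed_if_AE_lebesgue_open[OF open_greaterThanLessThan C ae'] by blast
  then have "closure {0<..<1::real} \<subseteq> ?C" by (rule closure_minimal[OF _ C])
  then show ?thesis using x by (auto simp: subset_iff)
qed

text \<open>Otherwise the interval from T to T + n alone would contribute n K to the integral, for
  every n.\<close>

lemma integrable_time_itv_small:
  fixes f :: "real \<Rightarrow> real"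
  assumes f: "integrable time_itv f" "AE t in time_itv. 0 \<le> f t"
    and K: "0 < K" and T: "0 \<le> T"
  shows "\<not> (AE t in time_itv. T < t \<longrightarrow> K \<le> f t)"
proof
  assume ge: "AE t in time_itv. T < t \<longrightarrow> K \<le> f t"
  have le: "real n * K \<le> (\<integral>t. f t \<partial>time_itv)" for n
  proof -
    let ?A = "{T<..<T + real n}"
    have A: "?A \<in> sets time_itv" "?A \<subseteq> {0<..}" using T by (auto simp: sets_restrict_space_iff)
    have meas: "measure time_itv ?A = real n" "emeasure time_itv ?A < \<infinity>"
      using A by (simp_all add: measure_restrict_space emeasure_restrict_space)
    have int: "integrable time_itv (indicator ?A :: real \<Rightarrow> real)"
      using A meas by (simp add: integrable_indicator_iff Int_absorb2)
    have "real n * K = (\<integral>t. indicator ?A t * K \<partial>time_itv)"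
      using meas A by (simp add: Int_absorb2)
    also have "\<dots> \<le> (\<integral>t. f t \<partial>time_itv)"
    proof (rule integral_mono_AE[OF _ f(1)])
      show "integrable time_itv (\<lambda>t. indicator ?A t * K)" using int by simp
      show "AE t in time_itv. indicator ?A t * K \<le> f t"
        using ge f(2) by eventually_elim (auto simp: indicator_def)
    qed
    finally show ?thesis .
  qed
  obtain n :: nat where "(\<integral>t. f t \<partial>time_itv) / K < real n" using reals_Archimedean2 by blast
  then show False using le[of n] K by (simp add: pos_divide_less_eq)
qed

lemma fun_of_scaleR: "AE x in unit_itv. fun_of (c *\<^sub>R f) x = c * fun_of f x"
proof -
  have "c *\<^sub>R f = abs_L2 (\<lambda>x. c * fun_of f x)"
    using scaleR_L2.abs_eq[of "fun_of f" c] by (simp add: square_integrable_fun_of abs_fun_of)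
  then show ?thesis
    using fun_of_abs[OF square_integrable_scale[OF square_integrable_fun_of]] by simp
qed

text \<open>The sup bound by the energy norm puts \<psi> below \<open>norm v\<close> almost
  everywhere, and continuity carries this to the single point where \<psi> is positive; the bound is
  \<psi>(x0).\<close>

lemma admissible_norm_ge:
  assumes "obstacle \<psi>" obtains m where "0 < m" "\<And>v. v \<in> admissible \<psi> \<Longrightarrow> m \<le> norm v"
proof -
  obtain x0 where x0: "x0 \<in> {0<..<1}" "\<psi> x0 > 0" and cont: "continuous_on {0..1} \<psi>"
    using assms by (auto simp: obstacle_def)
  have "\<psi> x0 \<le> norm v" if v: "v \<in> admissible \<psi>" for v
  proof -
    have "AE x in unit_itv. \<psi> x \<le> fun_of (to_L2 v) x" using v by (simp add: admissible_def)
    then have "AE x in unit_itv. 0 \<le> norm v - \<psi> x"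
      using abs_fun_of_to_L2_le[of v] by eventually_elim auto
    then have "0 \<le> norm v - \<psi> x0"
      using x0 by (intro nonneg_if_AE_unit_itv[of "\<lambda>x. norm v - \<psi> x"] continuous_intros cont) auto
    then show ?thesis by simp
  qed
  with x0(2) show thesis by (rule that)
qed

text \<open>Away from the obstacle, shrinking the solution slightly is an admissible variation.\<close>

lemma variational_inequality_no_contact:
  assumes psi: "continuous_on {0..1} \<psi>" and v: "v \<in> admissible \<psi>"
    and V: "continuous_on {0..1} V" "AE x in unit_itv. V x = fun_of (to_L2 v) x"
    and no_contact: "\<And>x. x \<in> {0..1} \<Longrightarrow> V x \<noteq> \<psi> x"
    and vi: "\<And>z. z \<in> admissible \<psi> \<Longrightarrow> 0 \<le> inner w (to_L2 z - to_L2 v) + energy_deriv v (z - v)"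
  shows "inner w (to_L2 v) + energy_deriv v v \<le> 0"
proof -
  have ge: "AE x in unit_itv. \<psi> x \<le> fun_of (to_L2 v) x" using v by (simp add: admissible_def)
  \<comment> \<open>Continuity makes the order pointwise, absence of contact makes it strict, and
    compactness yields a positive least gap.\<close>
  have "AE x in unit_itv. 0 \<le> V x - \<psi> x" using ge V(2) by eventually_elim simp
  then have "0 \<le> V x - \<psi> x" if "x \<in> {0..1}" for x
    using that by (intro nonneg_if_AE_unit_itv[of "\<lambda>x. V x - \<psi> x"] continuous_intros V psi)
  with no_contact have gt: "0 < V x - \<psi> x" if "x \<in> {0..1}" for x using that by force
  obtain y where y: "y \<in> {0..1}" "\<And>x. x \<in> {0..1} \<Longrightarrow> V y - \<psi> y \<le> V x - \<psi> x"
    using continuous_attains_inf[OF compact_Icc _ continuous_on_diff[OF V(1) psi]] by auto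
  define \<delta> where "\<delta> = V y - \<psi> y"
  have \<delta>: "0 < \<delta>" using gt[OF y(1)] by (simp add: \<delta>_def)
  have "compact (V ` {0..1})" by (intro compact_continuous_image V) simp
  then obtain B where B: "B > 0" "\<And>x. x \<in> {0..1} \<Longrightarrow> \<bar>V x\<bar> \<le> B"
    using compact_imp_bounded bounded_pos by (metis imageI real_norm_def)
  \<comment> \<open>Shrinking by this factor lowers V by at most \<open>\<epsilon> * B\<close>,
    which is the least gap \<open>\<delta>\<close>.\<close>
  define \<epsilon> where "\<epsilon> = \<delta> / B"
  have \<epsilon>: "0 < \<epsilon>" using \<delta> B(1) by (simp add: \<epsilon>_def)
  define z where "z = (1 - \<epsilon>) *\<^sub>R v"
  have "AE x in unit_itv. \<psi> x \<le> fun_of ((1 - \<epsilon>) *\<^sub>R to_L2 v) x"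
    using fun_of_scaleR[of "1 - \<epsilon>" "to_L2 v"] V(2) AE_space
  proof eventually_elim
    case (elim x)
    then have x: "x \<in> {0..1}" by simp
    have "\<epsilon> * V x \<le> \<epsilon> * B" using B(2)[OF x] \<epsilon> by (intro mult_left_mono) auto
    also have "\<dots> = \<delta>" using B(1) by (simp add: \<epsilon>_def)
    also have "\<dots> \<le> V x - \<psi> x" unfolding \<delta>_def by (rule y(2)[OF x])
    finally show ?case using elim by (simp add: left_diff_distrib)
  qed
  then have "z \<in> admissible \<psi>" by (simp add: admissible_def z_def scaleR_navier_space.rep_eq)
  note vi = vi[OF this]
  have lin: "linear (energy_deriv v)" by (rule bounded_linear.linear[OF bounded_linear_energy_deriv])
  have "z - v = (- \<epsilon>) *\<^sub>R v" by (simp add: z_def algebra_simps)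
  then have "energy_deriv v (z - v) = - \<epsilon> * energy_deriv v v"
    using linear_scale[OF lin, of "- \<epsilon>" v] by simp
  moreover have "inner w (to_L2 z - to_L2 v) = - \<epsilon> * inner w (to_L2 v)"
    unfolding z_def scaleR_navier_space.rep_eq by (simp add: inner_diff_right algebra_simps)
  ultimately have "0 \<le> - \<epsilon> * (inner w (to_L2 v) + energy_deriv v v)"
    using vi by (simp only: distrib_left)
  then show ?thesis using \<epsilon> by (simp add: zero_le_mult_iff mult_le_0_iff)
qed

text \<open>G is continuous at \<open>sqrt (2 / 3)\<close>, so some \<open>s0\<close> strictly below
  it still satisfies G(s0) > sqrt e. It depends on the energy bound alone, hence serves all times of
  the flow at once.\<close>

lemma energy_lt_imp_slope_le:
  assumes "e < (G_fun (sqrt (2 / 3)))\<^sup>2"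
  obtains s0 where "0 \<le> s0" "s0\<^sup>2 < 2 / 3"
    "\<And>v x. energy v \<le> e \<Longrightarrow> x \<in> {0..1} \<Longrightarrow> \<bar>slope v x\<bar> \<le> s0"
proof -
  let ?s = "sqrt (2 / 3)"
  have G: "0 < G_fun ?s" using G_fun_strict_mono[of 0 ?s] by (simp add: G_fun_0)
  have lt: "sqrt e < G_fun ?s" using assms G by (intro real_less_lsqrt) auto
  have "(G_fun \<longlongrightarrow> G_fun ?s) (at_left ?s)"
    using DERIV_isCont[OF DERIV_G_fun[of ?s]] by (simp add: isCont_def filterlim_at_split)
  then have "eventually (\<lambda>s. sqrt e < G_fun s) (at_left ?s)"
    using lt by (rule order_tendstoD(1))
  moreover have "eventually (\<lambda>s. s \<in> {0<..<?s}) (at_left ?s)"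
    by (rule eventually_at_left_real) simp
  ultimately have "eventually (\<lambda>s. sqrt e < G_fun s \<and> s \<in> {0<..<?s}) (at_left ?s)"
    by (rule eventually_conj)
  then obtain s0 where s0: "sqrt e < G_fun s0" "0 < s0" "s0 < ?s"
    using eventually_happens by fastforce
  have "s0\<^sup>2 < ?s\<^sup>2" using s0 by (intro power_strict_mono) auto
  then have "s0\<^sup>2 < 2 / 3" by simp
  moreover have "\<bar>slope v x\<bar> \<le> s0" if "energy v \<le> e" "x \<in> {0..1}" for v x
  proof (rule abs_le_if_abs_G_fun_le)
    have "sqrt (energy v) \<le> sqrt e" using that(1) by simp
    then show "\<bar>G_fun (slope v x)\<bar> \<le> G_fun s0" using abs_G_fun_slope_le[OF that(2), of v] s0(1) by linarith
  qed
  ultimately show thesis using s0(2) by (intro that[of s0]) auto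
qed

lemma FVI_gradient_flow_contact:
  assumes psi: "obstacle \<psi>" and e: "energy u0 < (G_fun (sqrt (2 / 3)))\<^sup>2"
    and flow: "FVI_gradient_flow \<psi> u0 u" and rep: "C1_representative u U" and T: "0 \<le> T"
  shows "\<exists>t>T. \<exists>x\<in>{0..1}. U t x = \<psi> x"
proof (rule ccontr)
  assume neg: "\<not> ?thesis"
  obtain m where m: "0 < m" "\<And>v. v \<in> admissible \<psi> \<Longrightarrow> m \<le> norm v"
    using admissible_norm_ge[OF psi] by blast
  obtain s0 where s0: "0 \<le> s0" "s0\<^sup>2 < 2 / 3"
    and slope: "\<And>v x. energy v \<le> energy u0 \<Longrightarrow> x \<in> {0..1} \<Longrightarrow> \<bar>slope v x\<bar> \<le> s0"
    using energy_lt_imp_slope_le[OF e] by blast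
  define c where "c = wt s0 * (2 - 5 * s0\<^sup>2 / (1 + s0\<^sup>2))"
  have "0 < 2 - 5 * s0\<^sup>2 / (1 + s0\<^sup>2)"
  proof -
    have "0 < 1 + s0\<^sup>2" by (simp add: add_pos_nonneg)
    then show ?thesis using s0(2) by (simp add: field_simps)
  qed
  then have c: "0 < c" unfolding c_def using wt_bounds(1)[of s0] by simp
  obtain w \<phi> C where w: "integrable time_itv (\<lambda>t. (norm (w t))\<^sup>2)"
    and adm: "AE t in time_itv. u t \<in> admissible \<psi>"
    and \<phi>: "antimono_on {0..} \<phi>" "\<phi> 0 = energy u0" "AE t in time_itv. energy (u t) = \<phi> t"
    and vi: "AE t in time_itv. \<forall>v\<in>admissible \<psi>.
           inner (w t) (to_L2 v - to_L2 (u t)) + frechet_derivative energy (at (u t)) (v - u t) \<ge> 0"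
    and C: "AE t in time_itv. norm (u t) \<le> C"
    using flow unfolding FVI_gradient_flow_def D12_deriv_def Linf_def by auto
  have U: "AE t in time_itv. AE x in unit_itv. U t x = fun_of (to_L2 (u t)) x"
    using rep by (simp add: C1_representative_def)
  have contU: "continuous_on {0..1} (U t)" if "t \<ge> 0" for t
    using rep that unfolding C1_representative_def by (meson DERIV_continuous_on)
  \<comment> \<open>Read off from c m^2 \<le> - (w, u) \<le> |w| |u|, where the \<open>L2\<close>
    norm of u is at most its energy norm; the maximum with 1 keeps the divisor positive.\<close>
  define K where "K = c * m\<^sup>2 / max C 1"
  have K: "0 < K" using c m(1) by (simp add: K_def)
  have "AE t in time_itv. T < t \<longrightarrow> K\<^sup>2 \<le> (norm (w t))\<^sup>2"
    using adm \<phi>(3) vi C U AE_space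
  proof eventually_elim
    case (elim t)
    show ?case
    proof
      assume "T < t"
      \<comment> \<open>\<open>AE_space\<close> supplies t > 0, so monotonicity can be used between
        0, where \<phi> is the initial energy, and t.\<close>
      have "\<phi> t \<le> \<phi> 0"
        using \<phi>(1) elim(6) by (auto simp: monotone_on_def)
      then have sl: "\<bar>slope (u t) x\<bar> \<le> s0" if "x \<in> {0..1}" for x
        using slope that elim(2) \<phi>(2) by simp
      have "c * (norm (u t))\<^sup>2 \<le> energy_deriv (u t) (u t)"
        unfolding c_def using s0 sl by (intro energy_deriv_self_ge) auto
      moreover have "c * m\<^sup>2 \<le> c * (norm (u t))\<^sup>2"
        using c m(1) m(2)[OF elim(1)] by (intro mult_left_mono power_mono) auto
      moreover have "inner (w t) (to_L2 (u t)) + energy_deriv (u t) (u t) \<le> 0"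
      proof (rule variational_inequality_no_contact[OF _ elim(1) _ elim(5)])
        show "continuous_on {0..1} \<psi>" using psi by (simp add: obstacle_def)
        show "continuous_on {0..1} (U t)" using elim(6) by (intro contU) simp
        show "U t x \<noteq> \<psi> x" if "x \<in> {0..1}" for x using neg \<open>T < t\<close> that by blast
        show "0 \<le> inner (w t) (to_L2 z - to_L2 (u t)) + energy_deriv (u t) (z - u t)"
          if "z \<in> admissible \<psi>" for z
          using elim(3) that by (simp add: frechet_derivative_energy)
      qed
      moreover have "- inner (w t) (to_L2 (u t)) \<le> norm (w t) * max C 1"
      proof -
        have "- inner (w t) (to_L2 (u t)) \<le> norm (w t) * norm (to_L2 (u t))"
          using Cauchy_Schwarz_ineq2[of "w t" "to_L2 (u t)"] by linarith
        also have "\<dots> \<le> norm (w t) * max C 1"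
          using norm_to_L2_le[of "u t"] elim(4) by (intro mult_left_mono) auto
        finally show ?thesis .
      qed
      ultimately have "c * m\<^sup>2 \<le> norm (w t) * max C 1" by linarith
      then have "K \<le> norm (w t)" by (simp add: K_def pos_divide_le_eq)
      then show "K\<^sup>2 \<le> (norm (w t))\<^sup>2" using K by (intro power_mono) auto
    qed
  qed
  moreover have "\<not> (AE t in time_itv. T < t \<longrightarrow> K\<^sup>2 \<le> (norm (w t))\<^sup>2)"
    using K T by (intro integrable_time_itv_small[OF w]) auto
  ultimately show False by contradiction
qed

theorem proposition2p7:
  fixes \<psi> :: "real \<Rightarrow> real" and u0 :: navier_space
    and u :: "real \<Rightarrow> navier_space" and U :: "real \<Rightarrow> real \<Rightarrow> real"
  assumes "obstacle \<psi>"
    and "u0 \<in> admissible \<psi>"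
    and "energy u0 < (G_fun (sqrt (2 / 3)))\<^sup>2"
    and "FVI_gradient_flow \<psi> u0 u"
    and "C1_representative u U"
  shows "\<exists>t :: nat \<Rightarrow> real. filterlim t at_top sequentially \<and>
           (\<forall>n. 0 \<le> t n \<and> {x \<in> {0..1}. U (t n) x = \<psi> x} \<noteq> {})"
proof -
  \<comment> \<open>Asking for contact after each integer forces the chosen times to
    diverge.\<close>
  have "\<forall>n::nat. \<exists>t>real n. \<exists>x\<in>{0..1}. U t x = \<psi> x"
    using FVI_gradient_flow_contact[OF assms(1,3,4,5)] by simp
  then obtain t where t: "\<And>n. real n < t n" "\<And>n. \<exists>x\<in>{0..1}. U (t n) x = \<psi> x" by metis
  have "filterlim t at_top sequentially"
    using t(1) by (intro filterlim_at_top_mono[OF filterlim_real_sequentially] always_eventually)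
      (auto intro: less_imp_le)
  moreover have "0 \<le> t n" for n using t(1)[of n] by linarith
  ultimately show ?thesis using t(2) by blast
qed

end
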